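(* Let $0<a<1$. As $n\to\infty$, the hitting distribution $\nu$ and the uniform distribution $\mu$ on the sphere of radius $an$ in $\mathcal S_n$ are asymptotically singular: $$d_{\mathrm{TV}}(\mu,\nu)\to1 .$$
   Context: $\mathcal S_n$ is the set of permutations of $\{1,\dots,n\}$, with $d(\sigma)$ the distance from the identity $I$ to $\sigma$ in the Cayley graph of $\mathcal S_n$ with respect to the set of all transpositions. The sphere of radius $an$ is $\partial B(an)=\{\sigma\in\mathcal S_n:d(\sigma)=\lfloor an\rfloor\}$. $\mu$ is the uniform distribution on $\partial B(an)$. $(\sigma_t)_{t\ge0}$ is the random walk on $\mathcal S_n$ started at $I$ which at rate $1$ multiplies the current permutation by a uniformly chosen transposition, and $\nu$ is the law of $\sigma_T$ with $T=\inf\{t>0:d(\sigma_t)=\lfloor an\rfloor\}$. $d_{\mathrm{TV}}$ is total variation distance (normalized to take values in $[0,1]$). *)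

theory Defs
  imports "HOL-Probability.Probability" "HOL-Combinatorics.Combinatorics"
begin

definition sym_group :: "nat \<Rightarrow> (nat \<Rightarrow> nat) set" where
  "sym_group n = {\<sigma>. \<sigma> permutes {1..n}}"

definition transpositions :: "nat \<Rightarrow> (nat \<Rightarrow> nat) set" where
  "transpositions n = {Transposition.transpose i j |i j. i \<in> {1..n} \<and> j \<in> {1..n} \<and> i \<noteq> j}"

definition cayley_graph :: "nat \<Rightarrow> ((nat \<Rightarrow> nat) \<times> (nat \<Rightarrow> nat)) set" where
  "cayley_graph n = {(\<sigma>, \<sigma> \<circ> \<tau>) |\<sigma> \<tau>. \<sigma> \<in> sym_group n \<and> \<tau> \<in> transpositions n}"

text \<open>Graph distance from the identity: the least length of a path in the Cayley graph.\<close>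

definition cayley_dist :: "nat \<Rightarrow> (nat \<Rightarrow> nat) \<Rightarrow> nat" where
  "cayley_dist n \<sigma> = (LEAST k. (id, \<sigma>) \<in> cayley_graph n ^^ k)"

definition sphere_perm :: "nat \<Rightarrow> real \<Rightarrow> (nat \<Rightarrow> nat) set" where
  "sphere_perm n a = {\<sigma> \<in> sym_group n. int (cayley_dist n \<sigma>) = \<lfloor>a * real n\<rfloor>}"

definition sphere_uniform :: "nat \<Rightarrow> real \<Rightarrow> (nat \<Rightarrow> nat) measure" where
  "sphere_uniform n a = uniform_measure (count_space (sym_group n)) (sphere_perm n a)"

text \<open>
  The continuous-time walk is realised by its jump construction: a sample point is a sequence of
  independent pairs, where the \<open>k\<close>-th pair consists of an exponential holding time of rate \<open>1\<close>
  and an independent uniform transposition. For \<open>n < 2\<close> there are no transpositions and the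
  measure degenerates; this is irrelevant for limits as \<open>n\<close> tends to infinity.
\<close>

definition walk_space :: "nat \<Rightarrow> (nat \<Rightarrow> real \<times> (nat \<Rightarrow> nat)) measure" where
  "walk_space n = PiM UNIV (\<lambda>_.
     density lborel (exponential_density 1) \<Otimes>\<^sub>M uniform_count_measure (transpositions n))"

definition jump_time :: "nat \<Rightarrow> (nat \<Rightarrow> real \<times> (nat \<Rightarrow> nat)) \<Rightarrow> real" where
  "jump_time k \<omega> = (\<Sum>i<k. fst (\<omega> i))"

text \<open>
  The number of jumps up to time \<open>t\<close>: the \<open>k\<close> with
  \<open>jump_time k \<omega> \<le> t < jump_time (Suc k) \<omega>\<close>, which exists for all \<open>t \<ge> 0\<close> almost surely.
  Writing it with \<open>LEAST\<close> makes every path right-continuous, also on the null set where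
  the jump times accumulate or fail to increase.
\<close>

definition num_jumps :: "(nat \<Rightarrow> real \<times> (nat \<Rightarrow> nat)) \<Rightarrow> real \<Rightarrow> nat" where
  "num_jumps \<omega> t = (LEAST k. t < jump_time (Suc k) \<omega>)"

primrec jump_chain :: "(nat \<Rightarrow> real \<times> (nat \<Rightarrow> nat)) \<Rightarrow> nat \<Rightarrow> (nat \<Rightarrow> nat)" where
  "jump_chain \<omega> 0 = id"
| "jump_chain \<omega> (Suc k) = jump_chain \<omega> k \<circ> snd (\<omega> k)"

definition walk :: "(nat \<Rightarrow> real \<times> (nat \<Rightarrow> nat)) \<Rightarrow> real \<Rightarrow> (nat \<Rightarrow> nat)" where
  "walk \<omega> t = jump_chain \<omega> (num_jumps \<omega> t)"

definition hitting_time :: "nat \<Rightarrow> real \<Rightarrow> (nat \<Rightarrow> real \<times> (nat \<Rightarrow> nat)) \<Rightarrow> real" where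
  "hitting_time n a \<omega> = Inf {t. t > 0 \<and> int (cayley_dist n (walk \<omega> t)) = \<lfloor>a * real n\<rfloor>}"

definition hitting_law :: "nat \<Rightarrow> real \<Rightarrow> (nat \<Rightarrow> nat) measure" where
  "hitting_law n a =
     distr (walk_space n) (count_space (sym_group n)) (\<lambda>\<omega>. walk \<omega> (hitting_time n a \<omega>))"

text \<open>Total variation distance, for probability measures on a common \<open>\<sigma>\<close>-algebra.\<close>

definition tv_dist :: "'a measure \<Rightarrow> 'a measure \<Rightarrow> real" where
  "tv_dist M N = (SUP A\<in>sets M. \<bar>measure M A - measure N A\<bar>)"

end

theory Submission
  imports Defs
begin

text \<open>
  The two laws are told apart by the density \<open>f\<close> of the fixed points and the density \<open>d\<close> of the
  points in two-cycles. Under the uniform law the pair \<open>(f, d)\<close> lies near the curve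
  \<open>d = f (1 - f)\<close>, and under the hitting law near the curve \<open>d = f\<^sup>2 log (1 / f)\<close>, which runs
  strictly below the first one for \<open>0 < f < 1\<close>. The test quantity is the \<open>discrepancy\<close>, which is
  \<open>n\<^sup>2 (d - f (1 - f))\<close> up to lower order terms.

  \<^bold>\<open>Uniform law.\<close> Take a point out of its cycle and insert it after another point. This move is
  reversible and keeps the number of cycles, hence the distance to the identity, so it leaves the
  uniform measure on the sphere invariant. The sum of the changes of the number of fixed points
  over all moves is exactly the discrepancy. Reversibility turns this into a bound for
  the second moment of the discrepancy (\<open>sum_discrepancy_squared\<close>), which shows that it is of smaller
  order than \<open>n\<^sup>2\<close>.

  \<^bold>\<open>Hitting law.\<close> In units of \<open>n\<close> steps, fixed points disappear at rate \<open>2 f\<close>, and points in two-cycles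
  disappear at rate \<open>4 d\<close> and are created at rate \<open>2 f\<^sup>2\<close> by merging fixed points; splitting a cycle
  contributes only to lower order. So after \<open>s n / 2\<close> steps \<open>f\<close> is near \<open>e\<^sup>-\<^sup>s\<close> and \<open>d\<close> is near
  \<open>s e\<^sup>-\<^sup>2\<^sup>s\<close>. The squared deviation from these curves is a supermartingale after a
  correction (\<open>step_avg_curve_error\<close>), and a maximal inequality for nonnegative supermartingales
  (\<open>prob_exceeds_le\<close>) bounds it at all times up to \<open>C n\<close> at once, so also at the random time at which
  the sphere is hit.

  \<^bold>\<open>Time window.\<close> The curves are apart by a constant as long as \<open>s\<close> stays between two positive
  constants (\<open>curve_gap\<close>). The sphere cannot be hit before step \<open>\<lfloor>a n\<rfloor>\<close>. That it is hit before step
  \<open>C n\<close>, with a probability that tends to one as \<open>C\<close> grows, follows because a permutation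
  strictly inside the sphere has at least \<open>(1 - a) n\<close> cycles, of which a positive proportion is short, whereas at time
  \<open>C n\<close> the walk has on average at most of the order of \<open>n e\<^sup>-\<^sup>C\<^sup>/\<^sup>2\<close> short cycles (\<open>step_avg_short_cycles\<close>).
\<close>

abbreviation transposition :: "nat \<Rightarrow> nat \<Rightarrow> nat \<Rightarrow> nat" where
  "transposition \<equiv> Transposition.transpose"

section \<open>Cycles and the distance from the identity\<close>

lemma finite_sym_group: "finite (sym_group n)"
  by (simp add: sym_group_def finite_permutations)

lemma transpose_in_sym_group:
  assumes "x \<in> {1..n}" "y \<in> {1..n}"
  shows "transposition x y \<in> sym_group n"
  using assms by (simp add: sym_group_def permutes_swap_id)

lemma comp_in_sym_group:
  assumes "\<sigma> \<in> sym_group n" "\<tau> \<in> sym_group n"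
  shows "\<sigma> \<circ> \<tau> \<in> sym_group n"
  using assms by (simp add: sym_group_def permutes_compose)

lemma id_in_sym_group: "id \<in> sym_group n"
  by (simp add: sym_group_def permutes_id)

lemma comp_transpose_in_sym_group:
  assumes "\<sigma> \<in> sym_group n" "x \<in> {1..n}" "y \<in> {1..n}"
  shows "\<sigma> \<circ> transposition x y \<in> sym_group n"
  using assms comp_in_sym_group transpose_in_sym_group by blast

lemma sym_group_permutation: "\<sigma> \<in> sym_group n \<Longrightarrow> permutation \<sigma>"
  unfolding sym_group_def permutation_permutes by auto

lemma sym_group_inj: "\<sigma> \<in> sym_group n \<Longrightarrow> inj \<sigma>"
  by (simp add: sym_group_def permutes_inj)

lemma sym_group_in: "\<sigma> \<in> sym_group n \<Longrightarrow> \<sigma> x \<in> {1..n} \<longleftrightarrow> x \<in> {1..n}"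
  by (simp add: sym_group_def permutes_in_image del: atLeastAtMost_iff)

lemma orbit_subset_sym:
  assumes "\<sigma> \<in> sym_group n" "x \<in> {1..n}"
  shows "orbit \<sigma> x \<subseteq> {1..n}"
proof
  fix z assume "z \<in> orbit \<sigma> x"
  then show "z \<in> {1..n}"
    by induct (use assms sym_group_in in blast)+
qed

lemma self_in_orbit_sym: "\<sigma> \<in> sym_group n \<Longrightarrow> x \<in> orbit \<sigma> x"
  by (simp add: permutation_self_in_orbit sym_group_permutation)

lemma orbit_eq_sym:
  assumes "\<sigma> \<in> sym_group n" "y \<in> orbit \<sigma> x"
  shows "orbit \<sigma> y = orbit \<sigma> x"
  using assms orbit_swap self_in_orbit_sym orbit_trans by (metis subsetI subset_antisym)

definition cycle_sets :: "nat \<Rightarrow> (nat \<Rightarrow> nat) \<Rightarrow> nat set set" where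
  "cycle_sets n \<sigma> = orbit \<sigma> ` {1..n}"

definition num_cycles :: "nat \<Rightarrow> (nat \<Rightarrow> nat) \<Rightarrow> nat" where
  "num_cycles n \<sigma> = card (cycle_sets n \<sigma>)"

lemma finite_cycle_sets: "finite (cycle_sets n \<sigma>)"
  by (simp add: cycle_sets_def)

lemma orbit_merge_subset:
  assumes \<sigma>: "\<sigma> \<in> sym_group n" and xy: "y \<notin> orbit \<sigma> x"
  shows "orbit \<sigma> y \<subseteq> orbit (\<sigma> \<circ> transposition x y) x"
proof
  let ?s = "\<sigma> \<circ> transposition x y"
  have disj: "x \<notin> orbit \<sigma> y"
    using \<sigma> xy orbit_swap self_in_orbit_sym by metis
  fix z assume "z \<in> orbit \<sigma> y"
  then show "z \<in> orbit ?s x"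
  proof induct
    case base
    have "\<sigma> y = ?s x" by simp
    then show ?case by (metis orbit.base)
  next
    case (step w)
    have "w \<noteq> x" using step disj by auto
    show ?case
    proof (cases "w = y")
      case True
      have "\<sigma> y = ?s x" by simp
      then show ?thesis using True by (metis orbit.base)
    next
      case False
      then have "\<sigma> w = ?s w" using \<open>w \<noteq> x\<close> by simp
      then show ?thesis using step by (metis orbit.step)
    qed
  qed
qed

text \<open>
  Composing with the transposition of two points in different cycles splices the two cycles:
  the new map follows the cycle of \<open>y\<close> from \<open>x\<close> on and returns to the cycle of \<open>x\<close> after \<open>y\<close>.
\<close>

lemma orbit_merge:
  assumes \<sigma>: "\<sigma> \<in> sym_group n" and x: "x \<in> {1..n}" and y: "y \<in> {1..n}"
    and xy: "y \<notin> orbit \<sigma> x"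
  shows "orbit (\<sigma> \<circ> transposition x y) x = orbit \<sigma> x \<union> orbit \<sigma> y"
proof
  let ?s = "\<sigma> \<circ> transposition x y"
  have s: "?s \<in> sym_group n" using comp_transpose_in_sym_group \<sigma> x y by blast
  have yx: "x \<notin> orbit \<sigma> y"
    using \<sigma> xy orbit_swap self_in_orbit_sym by metis
  have 1: "orbit \<sigma> y \<subseteq> orbit ?s x" using orbit_merge_subset[OF \<sigma> xy] .
  then have "y \<in> orbit ?s x" using self_in_orbit_sym[OF \<sigma>] by blast
  then have "orbit ?s y = orbit ?s x" using orbit_eq_sym s by blast
  moreover have "orbit \<sigma> x \<subseteq> orbit (\<sigma> \<circ> transposition y x) y"
    using orbit_merge_subset[OF \<sigma> yx] .
  ultimately show "orbit \<sigma> x \<union> orbit \<sigma> y \<subseteq> orbit ?s x"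
    using 1 by (simp add: Transposition.transpose_commute)
  show "orbit ?s x \<subseteq> orbit \<sigma> x \<union> orbit \<sigma> y"
  proof
    fix z assume "z \<in> orbit ?s x"
    then show "z \<in> orbit \<sigma> x \<union> orbit \<sigma> y"
    proof induct
      case base
      then show ?case by (auto intro: orbit.intros)
    next
      case (step w)
      show ?case
        using step by (cases "w = x"; cases "w = y") (auto intro: orbit.intros)
    qed
  qed
qed

lemma orbit_unaffected:
  assumes \<sigma>: "\<sigma> \<in> sym_group n" and "x \<notin> orbit \<sigma> z" "y \<notin> orbit \<sigma> z"
  shows "orbit (\<sigma> \<circ> transposition x y) z = orbit \<sigma> z"
proof (rule orbit_cong0[where A = "orbit \<sigma> z"])
  have z: "z \<in> orbit \<sigma> z" using \<sigma> self_in_orbit_sym by blast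
  show "z \<in> orbit \<sigma> z" by (rule z)
  show "\<sigma> \<circ> transposition x y \<in> orbit \<sigma> z \<rightarrow> orbit \<sigma> z"
    using assms by (auto simp: Transposition.transpose_def intro: orbit.intros)
  show "(\<sigma> \<circ> transposition x y) w = \<sigma> w" if "w \<in> orbit \<sigma> z" for w
    using that assms by (auto simp: Transposition.transpose_def)
qed

lemma cycle_sets_merge:
  assumes \<sigma>: "\<sigma> \<in> sym_group n" and x: "x \<in> {1..n}" and y: "y \<in> {1..n}"
    and xy: "y \<notin> orbit \<sigma> x"
  shows "cycle_sets n (\<sigma> \<circ> transposition x y) =
    insert (orbit \<sigma> x \<union> orbit \<sigma> y) (cycle_sets n \<sigma> - {orbit \<sigma> x, orbit \<sigma> y})"
proof -
  let ?s = "\<sigma> \<circ> transposition x y"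
  let ?U = "orbit \<sigma> x \<union> orbit \<sigma> y"
  have s: "?s \<in> sym_group n" using comp_transpose_in_sym_group \<sigma> x y by blast
  have U: "orbit ?s x = ?U" by (rule orbit_merge[OF assms])
  have in_U: "orbit ?s z = ?U" if "z \<in> ?U" for z
    using that U orbit_eq_sym[OF s] by blast
  have out_U: "orbit ?s z = orbit \<sigma> z \<and> orbit \<sigma> z \<noteq> orbit \<sigma> x \<and> orbit \<sigma> z \<noteq> orbit \<sigma> y"
    if "z \<notin> ?U" for z
  proof -
    have "x \<notin> orbit \<sigma> z" "y \<notin> orbit \<sigma> z"
      using that orbit_eq_sym[OF \<sigma>] self_in_orbit_sym[OF \<sigma>] by blast+
    then show ?thesis
      using that orbit_unaffected[OF \<sigma>] self_in_orbit_sym[OF \<sigma>] by blast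
  qed
  have sub: "cycle_sets n ?s \<subseteq> insert ?U (cycle_sets n \<sigma> - {orbit \<sigma> x, orbit \<sigma> y})"
    unfolding cycle_sets_def
  proof
    fix B assume "B \<in> orbit ?s ` {1..n}"
    then obtain z where z: "z \<in> {1..n}" "B = orbit ?s z" by blast
    then show "B \<in> insert ?U (orbit \<sigma> ` {1..n} - {orbit \<sigma> x, orbit \<sigma> y})"
      using in_U out_U by (cases "z \<in> ?U") auto
  qed
  have "?U \<in> cycle_sets n ?s" unfolding cycle_sets_def using U x by blast
  moreover have "B \<in> cycle_sets n ?s" if B: "B \<in> cycle_sets n \<sigma> - {orbit \<sigma> x, orbit \<sigma> y}" for B
  proof -
    obtain z where z: "z \<in> {1..n}" "B = orbit \<sigma> z" using B unfolding cycle_sets_def by blast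
    have "z \<notin> ?U" using B z orbit_eq_sym[OF \<sigma>] by blast
    then show ?thesis using out_U z unfolding cycle_sets_def by blast
  qed
  ultimately show ?thesis using sub by blast
qed

lemma num_cycles_merge:
  assumes \<sigma>: "\<sigma> \<in> sym_group n" and x: "x \<in> {1..n}" and y: "y \<in> {1..n}"
    and xy: "y \<notin> orbit \<sigma> x"
  shows "num_cycles n \<sigma> = Suc (num_cycles n (\<sigma> \<circ> transposition x y))"
proof -
  let ?U = "orbit \<sigma> x \<union> orbit \<sigma> y"
  have ne: "orbit \<sigma> x \<noteq> orbit \<sigma> y" using xy self_in_orbit_sym[OF \<sigma>] by blast
  have "?U \<notin> cycle_sets n \<sigma>"
  proof
    assume "?U \<in> cycle_sets n \<sigma>"
    then obtain z where z: "?U = orbit \<sigma> z" unfolding cycle_sets_def by auto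
    then have "x \<in> orbit \<sigma> z" "y \<in> orbit \<sigma> z" using self_in_orbit_sym[OF \<sigma>] by blast+
    then show False using ne orbit_eq_sym[OF \<sigma>] by blast
  qed
  moreover have "{orbit \<sigma> x, orbit \<sigma> y} \<subseteq> cycle_sets n \<sigma>"
    using x y unfolding cycle_sets_def by blast
  moreover have "card (cycle_sets n \<sigma>) \<ge> 2"
    using card_mono[OF finite_cycle_sets calculation(2)] ne by simp
  ultimately show ?thesis
    unfolding num_cycles_def cycle_sets_merge[OF assms]
    using ne by (simp add: finite_cycle_sets card_Diff_subset)
qed

text \<open>
  The converse of the splice: if \<open>x\<close> and \<open>y\<close> lie on one cycle, then the new cycle through \<open>x\<close> is
  the arc that leads from \<open>\<sigma> y\<close> to \<open>x\<close>, and \<open>y\<close> is not on it. That the arc has \<open>i\<close> points, where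
  \<open>\<sigma>\<^sup>i y = x\<close>, is what makes splitting off a short cycle unlikely: for given \<open>x\<close> there are only
  \<open>L\<close> points \<open>y\<close> from which \<open>x\<close> is reached in at most \<open>L\<close> steps.
\<close>

lemma orbit_split:
  assumes \<sigma>: "\<sigma> \<in> sym_group n" and xy: "x \<noteq> y" and y: "y \<in> orbit \<sigma> x"
  obtains i where "(\<sigma> ^^ i) y = x" "1 \<le> i" "card (orbit (\<sigma> \<circ> transposition x y) x) = i"
    "y \<notin> orbit (\<sigma> \<circ> transposition x y) x"
proof -
  let ?s = "\<sigma> \<circ> transposition x y"
  have x: "x \<in> orbit \<sigma> y" using y \<sigma> orbit_swap self_in_orbit_sym by metis
  define i where "i = (LEAST i. 1 \<le> i \<and> (\<sigma> ^^ i) y = x)"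
  have "\<exists>i. 1 \<le> i \<and> (\<sigma> ^^ i) y = x"
    using x unfolding orbit_altdef by (auto simp: Suc_le_eq)
  then have i: "1 \<le> i" "(\<sigma> ^^ i) y = x"
    unfolding i_def by (metis (mono_tags, lifting) LeastI_ex)+
  have least: "(\<sigma> ^^ j) y \<noteq> x" if "1 \<le> j" "j < i" for j
    using that not_less_Least unfolding i_def by blast
  define W where "W = (\<lambda>j. (\<sigma> ^^ j) y) ` {1..i}"
  have not_y: "(\<sigma> ^^ j) y \<noteq> y" if "1 \<le> j" "j \<le> i" for j
  proof
    assume eq: "(\<sigma> ^^ j) y = y"
    then have "j < i" using that i xy by (cases "j = i") auto
    have "(\<sigma> ^^ (i - j)) y = (\<sigma> ^^ (i - j)) ((\<sigma> ^^ j) y)" using eq by simp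
    also have "\<dots> = (\<sigma> ^^ (i - j + j)) y" by (simp only: funpow_add o_apply)
    also have "\<dots> = x" using i \<open>j < i\<close> by simp
    finally have "(\<sigma> ^^ (i - j)) y = x" .
    moreover have "1 \<le> i - j" "i - j < i" using that \<open>j < i\<close> by auto
    ultimately show False using least by blast
  qed
  have inj: "inj_on (\<lambda>j. (\<sigma> ^^ j) y) {1..i}"
  proof (rule linorder_inj_onI)
    fix j k assume jk: "j < k" "j \<in> {1..i}" "k \<in> {1..i}"
    show "(\<sigma> ^^ j) y \<noteq> (\<sigma> ^^ k) y"
    proof
      assume eq: "(\<sigma> ^^ j) y = (\<sigma> ^^ k) y"
      have "(\<sigma> ^^ (i - k + j)) y = (\<sigma> ^^ (i - k)) ((\<sigma> ^^ j) y)" by (simp add: funpow_add)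
      also have "\<dots> = (\<sigma> ^^ (i - k + k)) y" using eq by (simp only: funpow_add o_apply)
      also have "\<dots> = x" using i jk by simp
      finally have "(\<sigma> ^^ (i - k + j)) y = x" .
      moreover have "1 \<le> i - k + j" "i - k + j < i" using jk by auto
      ultimately show False using least by blast
    qed
  qed auto
  have closed: "?s w \<in> W" if w: "w \<in> W" for w
  proof -
    obtain j where j: "j \<in> {1..i}" "w = (\<sigma> ^^ j) y" using w unfolding W_def by auto
    show ?thesis
    proof (cases "j = i")
      case True
      then have "?s w = (\<sigma> ^^ 1) y" using i j by simp
      then show ?thesis unfolding W_def using i by (metis atLeastAtMost_iff image_eqI le_refl)
    next
      case False
      then have "w \<noteq> x" "w \<noteq> y" using j least not_y by auto
      then have "?s w = (\<sigma> ^^ Suc j) y" using j by simp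
      then show ?thesis unfolding W_def using j False by (intro image_eqI[of _ _ "Suc j"]) auto
    qed
  qed
  have "orbit ?s x \<subseteq> W"
  proof
    fix z assume "z \<in> orbit ?s x"
    then show "z \<in> W"
    proof induct
      case base
      have "x \<in> W" unfolding W_def using i by (intro image_eqI[of _ _ i]) auto
      then show ?case by (rule closed)
    next
      case (step w)
      then show ?case using closed by blast
    qed
  qed
  moreover have "W \<subseteq> orbit ?s x"
  proof -
    have "(\<sigma> ^^ j) y \<in> orbit ?s x" if "1 \<le> j" "j \<le> i" for j
      using that
    proof (induct j rule: dec_induct)
      case base
      have "(\<sigma> ^^ 1) y = ?s x" by simp
      then show ?case by (metis orbit.base)
    next
      case (step j)
      have "(\<sigma> ^^ j) y \<noteq> x" "(\<sigma> ^^ j) y \<noteq> y" using step least not_y by auto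
      then have "(\<sigma> ^^ Suc j) y = ?s ((\<sigma> ^^ j) y)" by simp
      then show ?case using step by (metis Suc_leD orbit.step)
    qed
    then show ?thesis unfolding W_def by auto
  qed
  ultimately have W: "orbit ?s x = W" by blast
  have "y \<notin> W" unfolding W_def using not_y by force
  moreover have "card W = i" unfolding W_def using card_image[OF inj] by simp
  ultimately show thesis using that i W by simp
qed

lemma comp_transpose_twice: "\<sigma> \<circ> transposition x y \<circ> transposition x y = \<sigma>"
  by (simp add: comp_assoc)

lemma num_cycles_split:
  assumes \<sigma>: "\<sigma> \<in> sym_group n" and x: "x \<in> {1..n}" and y: "y \<in> {1..n}"
    and xy: "x \<noteq> y" "y \<in> orbit \<sigma> x"
  shows "num_cycles n (\<sigma> \<circ> transposition x y) = Suc (num_cycles n \<sigma>)"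
proof -
  have "y \<notin> orbit (\<sigma> \<circ> transposition x y) x"
    using orbit_split[OF \<sigma> xy] by blast
  then show ?thesis
    using num_cycles_merge[of "\<sigma> \<circ> transposition x y" n x y] comp_transpose_in_sym_group[OF \<sigma> x y] x y
    by (simp add: comp_assoc)
qed

lemma num_cycles_id: "num_cycles n id = n"
proof -
  have "orbit id x = {x}" for x :: nat by (simp add: orbit_eq_singleton_iff)
  then have "cycle_sets n id = (\<lambda>x. {x}) ` {1..n}" unfolding cycle_sets_def by auto
  then show ?thesis unfolding num_cycles_def by (simp add: card_image)
qed

lemma num_cycles_le: "num_cycles n \<sigma> \<le> n"
  unfolding num_cycles_def cycle_sets_def using card_image_le[of "{1..n}" "orbit \<sigma>"] by simp

lemma transpositionsE:
  assumes "\<tau> \<in> transpositions n"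
  obtains x y where "\<tau> = transposition x y" "x \<in> {1..n}" "y \<in> {1..n}" "x \<noteq> y"
  using assms unfolding transpositions_def by blast

lemma transpositions_subset: "transpositions n \<subseteq> sym_group n"
  unfolding transpositions_def using transpose_in_sym_group by auto

lemma num_cycles_step:
  assumes \<sigma>: "\<sigma> \<in> sym_group n" and \<tau>: "\<tau> \<in> transpositions n"
  shows "num_cycles n \<sigma> \<le> Suc (num_cycles n (\<sigma> \<circ> \<tau>))"
proof -
  obtain x y where xy: "\<tau> = transposition x y" "x \<in> {1..n}" "y \<in> {1..n}" "x \<noteq> y"
    by (rule transpositionsE[OF \<tau>])
  have "num_cycles n (\<sigma> \<circ> \<tau>) = Suc (num_cycles n \<sigma>) \<or>
      num_cycles n \<sigma> = Suc (num_cycles n (\<sigma> \<circ> \<tau>))"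
    unfolding xy(1) using num_cycles_split[OF \<sigma> xy(2-4)] num_cycles_merge[OF \<sigma> xy(2,3)]
    by blast
  then show ?thesis by linarith
qed

lemma cayley_path_lower:
  assumes "(id, \<sigma>) \<in> cayley_graph n ^^ k"
  shows "\<sigma> \<in> sym_group n \<and> n \<le> num_cycles n \<sigma> + k"
  using assms
proof (induct k arbitrary: \<sigma>)
  case 0
  then have "\<sigma> = id" by (metis relpow_0_E)
  moreover have "n \<le> num_cycles n id + 0" by (simp only: num_cycles_id)
  ultimately show ?case using id_in_sym_group by metis
next
  case (Suc k)
  then obtain \<rho> where \<rho>: "(id, \<rho>) \<in> cayley_graph n ^^ k" "(\<rho>, \<sigma>) \<in> cayley_graph n"
    by (meson relpow_Suc_E)
  then obtain \<tau> where \<tau>: "\<rho> \<in> sym_group n" "\<tau> \<in> transpositions n" "\<sigma> = \<rho> \<circ> \<tau>"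
    unfolding cayley_graph_def by auto
  have "\<rho> \<circ> \<tau> \<in> sym_group n"
    using comp_in_sym_group \<tau> transpositions_subset by blast
  then show ?case
    unfolding \<tau>(3) using Suc(1)[OF \<rho>(1)] num_cycles_step[OF \<tau>(1,2)] by linarith
qed

lemma moved_point_exists:
  assumes "\<sigma> \<in> sym_group n" "num_cycles n \<sigma> < n"
  shows "\<exists>x\<in>{1..n}. \<sigma> x \<noteq> x"
proof -
  have "\<exists>x. \<sigma> x \<noteq> x"
    using assms num_cycles_id by (metis eq_id_iff less_irrefl)
  then show ?thesis using assms(1) unfolding sym_group_def permutes_def by blast
qed

lemma cayley_path_upper:
  assumes "\<sigma> \<in> sym_group n" "num_cycles n \<sigma> + k = n"
  shows "(id, \<sigma>) \<in> cayley_graph n ^^ k"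
  using assms
proof (induct k arbitrary: \<sigma>)
  case 0
  have "\<sigma> = id"
  proof (rule ccontr)
    assume "\<sigma> \<noteq> id"
    then obtain x where "\<sigma> x \<noteq> x" by (auto simp: fun_eq_iff)
    then have x: "x \<in> {1..n}" using 0 unfolding sym_group_def permutes_def by blast
    have "num_cycles n (\<sigma> \<circ> transposition x (\<sigma> x)) = Suc (num_cycles n \<sigma>)"
      using x \<open>\<sigma> x \<noteq> x\<close> 0 sym_group_in by (intro num_cycles_split) (auto intro: orbit.base)
    then show False using 0 num_cycles_le[of n "\<sigma> \<circ> transposition x (\<sigma> x)"] by simp
  qed
  show ?case unfolding \<open>\<sigma> = id\<close> by (rule relpow_0_I)
next
  case (Suc k)
  then obtain x where x: "x \<in> {1..n}" "\<sigma> x \<noteq> x" 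
    using moved_point_exists[of \<sigma> n] by auto
  have y: "\<sigma> x \<in> {1..n}" using x Suc sym_group_in by blast
  let ?\<rho> = "\<sigma> \<circ> transposition x (\<sigma> x)"
  have "num_cycles n ?\<rho> = Suc (num_cycles n \<sigma>)"
    using x y Suc by (intro num_cycles_split) (auto intro: orbit.base)
  moreover have \<rho>: "?\<rho> \<in> sym_group n" using comp_transpose_in_sym_group Suc x y by blast
  ultimately have "(id, ?\<rho>) \<in> cayley_graph n ^^ k" using Suc(1,3) by (metis add_Suc_shift)
  moreover have "transposition x (\<sigma> x) \<in> transpositions n"
    unfolding transpositions_def using x y by (metis (mono_tags, lifting) mem_Collect_eq)
  then have "(?\<rho>, ?\<rho> \<circ> transposition x (\<sigma> x)) \<in> cayley_graph n"
    unfolding cayley_graph_def using \<rho> by blast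
  then have "(?\<rho>, \<sigma>) \<in> cayley_graph n" by (simp add: comp_transpose_twice)
  ultimately show ?case by (rule relpow_Suc_I)
qed

text \<open>
  A transposition changes the number of cycles by exactly one, and as long as some point is moved
  there is one that increases it; so the distance to the identity is the number of missing cycles.
\<close>

lemma cayley_dist_eq:
  assumes "\<sigma> \<in> sym_group n"
  shows "cayley_dist n \<sigma> = n - num_cycles n \<sigma>"
  unfolding cayley_dist_def
proof (rule Least_equality)
  show "(id, \<sigma>) \<in> cayley_graph n ^^ (n - num_cycles n \<sigma>)"
    using assms num_cycles_le by (intro cayley_path_upper) auto
  show "n - num_cycles n \<sigma> \<le> k" if "(id, \<sigma>) \<in> cayley_graph n ^^ k" for k
    using cayley_path_lower[OF that] by linarith
qed

lemma ex_num_cycles: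
  assumes "1 \<le> N" "N \<le> n"
  shows "\<exists>\<sigma>\<in>sym_group n. num_cycles n \<sigma> = N"
  using assms(2,1)
proof (induct N rule: inc_induct)
  case base
  then show ?case using id_in_sym_group num_cycles_id by blast
next
  case (step N)
  then obtain \<sigma> where \<sigma>: "\<sigma> \<in> sym_group n" "num_cycles n \<sigma> = Suc N" by auto
  have "\<exists>x\<in>{1..n}. \<exists>y\<in>{1..n}. y \<notin> orbit \<sigma> x"
  proof (rule ccontr)
    assume *: "\<not> ?thesis"
    have "1 \<in> {1..n}" using step by simp
    then have "orbit \<sigma> x = orbit \<sigma> 1" if "x \<in> {1..n}" for x
      using * that orbit_eq_sym[OF \<sigma>(1), of x 1] by blast
    then have "cycle_sets n \<sigma> \<subseteq> {orbit \<sigma> 1}"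
      unfolding cycle_sets_def by blast
    then have "num_cycles n \<sigma> \<le> card {orbit \<sigma> 1}"
      unfolding num_cycles_def by (intro card_mono) auto
    then show False using \<sigma>(2) step by simp
  qed
  then obtain x y where "x \<in> {1..n}" "y \<in> {1..n}" "y \<notin> orbit \<sigma> x" by blast
  then have "num_cycles n (\<sigma> \<circ> transposition x y) = N" "\<sigma> \<circ> transposition x y \<in> sym_group n"
    using num_cycles_merge[OF \<sigma>(1), of x y] \<sigma>(2) comp_transpose_in_sym_group[OF \<sigma>(1), of x y]
    by linarith+
  then show ?case by blast
qed

section \<open>Fixed points and two-cycles\<close>

definition fixed_pts :: "nat \<Rightarrow> (nat \<Rightarrow> nat) \<Rightarrow> real" where
  "fixed_pts n \<sigma> = (\<Sum>z\<in>{1..n}. of_bool (\<sigma> z = z))"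

text \<open>Points are counted here, so this is twice the number of two-cycles.\<close>

definition two_pts :: "nat \<Rightarrow> (nat \<Rightarrow> nat) \<Rightarrow> real" where
  "two_pts n \<sigma> = (\<Sum>z\<in>{1..n}. of_bool (\<sigma> z \<noteq> z \<and> \<sigma> (\<sigma> z) = z))"

lemma fixed_pts_bounds: "0 \<le> fixed_pts n \<sigma>" "fixed_pts n \<sigma> \<le> n"
proof -
  show "0 \<le> fixed_pts n \<sigma>" unfolding fixed_pts_def by (intro sum_nonneg) simp
  have "fixed_pts n \<sigma> \<le> (\<Sum>z\<in>{1..n}. 1)" unfolding fixed_pts_def by (intro sum_mono) simp
  then show "fixed_pts n \<sigma> \<le> n" by simp
qed

lemma two_pts_bounds: "0 \<le> two_pts n \<sigma>" "two_pts n \<sigma> \<le> n"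
proof -
  show "0 \<le> two_pts n \<sigma>" unfolding two_pts_def by (intro sum_nonneg) simp
  have "two_pts n \<sigma> \<le> (\<Sum>z\<in>{1..n}. 1)" unfolding two_pts_def by (intro sum_mono) simp
  then show "two_pts n \<sigma> \<le> n" by simp
qed

lemma sum_of_bool_diff_le:
  assumes "finite A" "finite U" "\<And>z. z \<in> A \<Longrightarrow> P z \<noteq> Q z \<Longrightarrow> z \<in> U"
  shows "\<bar>(\<Sum>z\<in>A. of_bool (P z)) - (\<Sum>z\<in>A. of_bool (Q z)) :: real\<bar> \<le> card U"
proof -
  have "\<bar>(\<Sum>z\<in>A. of_bool (P z)) - (\<Sum>z\<in>A. of_bool (Q z)) :: real\<bar>
      = \<bar>\<Sum>z\<in>A. of_bool (P z) - of_bool (Q z) :: real\<bar>"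
    by (simp add: sum_subtractf)
  also have "\<dots> \<le> (\<Sum>z\<in>A. \<bar>of_bool (P z) - of_bool (Q z) :: real\<bar>)" by (rule sum_abs)
  also have "\<dots> \<le> (\<Sum>z\<in>A. of_bool (z \<in> U))"
    using assms(3) by (intro sum_mono) (auto simp: of_bool_def)
  also have "\<dots> = card (A \<inter> U)" using assms(1) by (simp add: sum_of_bool_eq)
  also have "\<dots> \<le> card U" using assms(2) by (simp add: card_mono)
  finally show ?thesis by simp
qed

lemma fixed_pts_transpose:
  "\<bar>fixed_pts n (\<sigma> \<circ> transposition x y) - fixed_pts n \<sigma>\<bar> \<le> 2"
proof -
  have "\<bar>fixed_pts n (\<sigma> \<circ> transposition x y) - fixed_pts n \<sigma>\<bar> \<le> card {x, y}"
    unfolding fixed_pts_def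
    by (rule sum_of_bool_diff_le) (auto simp: Transposition.transpose_def split: if_splits)
  also have "\<dots> \<le> 2" by (simp add: card_insert_if)
  finally show ?thesis .
qed

lemma two_pts_transpose:
  assumes \<sigma>: "\<sigma> \<in> sym_group n"
  shows "\<bar>two_pts n (\<sigma> \<circ> transposition x y) - two_pts n \<sigma>\<bar> \<le> 4"
proof -
  let ?U = "{x, y, inv \<sigma> x, inv \<sigma> y}"
  have "inv \<sigma> (\<sigma> z) = z" for z using sym_group_inj[OF \<sigma>] by simp
  then have "\<bar>two_pts n (\<sigma> \<circ> transposition x y) - two_pts n \<sigma>\<bar> \<le> card ?U"
    unfolding two_pts_def
    by (intro sum_of_bool_diff_le) (auto simp: Transposition.transpose_def split: if_splits)
  also have "\<dots> \<le> 4" by (simp add: card_insert_if)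
  finally show ?thesis .
qed

section \<open>The uniform measure on the sphere\<close>

text \<open>
  The move takes the successor \<open>\<sigma> p\<close> of \<open>p\<close> out of its cycle and inserts it after \<open>y\<close>. The first
  transposition splits, the second merges, so the number of cycles is kept.
\<close>

definition move :: "(nat \<Rightarrow> nat) \<Rightarrow> nat \<Rightarrow> nat \<Rightarrow> nat \<Rightarrow> nat" where
  "move \<sigma> p y = \<sigma> \<circ> transposition p (\<sigma> p) \<circ> transposition (\<sigma> p) y"

definition moves :: "nat \<Rightarrow> (nat \<Rightarrow> nat) \<Rightarrow> (nat \<times> nat) set" where
  "moves n \<sigma> = {(p, y). p \<in> {1..n} \<and> y \<in> {1..n} \<and> \<sigma> p \<noteq> p \<and> y \<noteq> \<sigma> p}"

lemma moves_subset: "moves n \<sigma> \<subseteq> {1..n} \<times> {1..n}"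
  unfolding moves_def by blast

lemma finite_moves: "finite (moves n \<sigma>)"
  by (rule finite_subset[OF moves_subset]) simp

lemma card_moves_le: "card (moves n \<sigma>) \<le> n * n"
  using card_mono[OF _ moves_subset[of n \<sigma>]] by simp

lemma move_in_sym_group:
  assumes "\<sigma> \<in> sym_group n" "(p, y) \<in> moves n \<sigma>"
  shows "move \<sigma> p y \<in> sym_group n"
proof -
  have "p \<in> {1..n}" "y \<in> {1..n}" "\<sigma> p \<in> {1..n}"
    using assms sym_group_in[of \<sigma> n p] unfolding moves_def by blast+
  then show ?thesis
    unfolding move_def using comp_transpose_in_sym_group assms(1) by blast
qed

lemma num_cycles_move:
  assumes \<sigma>: "\<sigma> \<in> sym_group n" and m: "(p, y) \<in> moves n \<sigma>"
  shows "num_cycles n (move \<sigma> p y) = num_cycles n \<sigma>"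
proof -
  let ?x = "\<sigma> p" and ?\<rho> = "\<sigma> \<circ> transposition p (\<sigma> p)"
  have p: "p \<in> {1..n}" and y: "y \<in> {1..n}" and x: "?x \<in> {1..n}" and "p \<noteq> ?x" "y \<noteq> ?x"
    using m sym_group_in[OF \<sigma>, of p] unfolding moves_def by auto
  have \<rho>: "?\<rho> \<in> sym_group n" using comp_transpose_in_sym_group \<sigma> p x by blast
  have "num_cycles n ?\<rho> = Suc (num_cycles n \<sigma>)"
    using num_cycles_split[OF \<sigma> p x \<open>p \<noteq> ?x\<close> orbit.base] .
  moreover have "orbit ?\<rho> ?x = {?x}" by (simp add: orbit_eq_singleton_iff)
  then have "y \<notin> orbit ?\<rho> ?x" using \<open>y \<noteq> ?x\<close> by blast
  then have "num_cycles n ?\<rho> = Suc (num_cycles n (move \<sigma> p y))"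
    unfolding move_def by (rule num_cycles_merge[OF \<rho> x y])
  ultimately show ?thesis by linarith
qed

text \<open>A move is undone by the move that puts the same point back after its old predecessor.\<close>

lemma move_reverse:
  assumes m: "(p, y) \<in> moves n \<sigma>"
  shows "move \<sigma> p y y = \<sigma> p" "(y, p) \<in> moves n (move \<sigma> p y)" "move (move \<sigma> p y) y p = \<sigma>"
proof -
  have *: "\<sigma> p \<noteq> p" "y \<noteq> \<sigma> p" "p \<in> {1..n}" "y \<in> {1..n}" using m unfolding moves_def by auto
  show 1: "move \<sigma> p y y = \<sigma> p" unfolding move_def by simp
  then show "(y, p) \<in> moves n (move \<sigma> p y)" using * unfolding moves_def by auto
  have "move (move \<sigma> p y) y p = move \<sigma> p y \<circ> transposition (\<sigma> p) y \<circ> transposition p (\<sigma> p)"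
    unfolding move_def[of "move \<sigma> p y"] 1 by (simp add: Transposition.transpose_commute)
  also have "\<dots> = \<sigma>" unfolding move_def by (simp add: comp_assoc)
  finally show "move (move \<sigma> p y) y p = \<sigma>" .
qed

lemma fixed_pts_move:
  assumes \<sigma>: "\<sigma> \<in> sym_group n" and m: "(p, y) \<in> moves n \<sigma>"
  shows "fixed_pts n (move \<sigma> p y) - fixed_pts n \<sigma> =
    (if y = p then 0 else of_bool (\<sigma> (\<sigma> p) = p) - of_bool (\<sigma> y = y))"
proof (cases "y = p")
  case True
  have "move \<sigma> p p = \<sigma>" unfolding move_def by (simp add: comp_assoc Transposition.transpose_commute)
  then show ?thesis using True by simp
next
  case False
  let ?x = "\<sigma> p"
  have *: "?x \<noteq> p" "y \<noteq> ?x" "p \<in> {1..n}" "y \<in> {1..n}" "?x \<in> {1..n}"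
    using m sym_group_in[OF \<sigma>, of p] unfolding moves_def by auto
  have inj: "\<sigma> a = \<sigma> b \<longleftrightarrow> a = b" for a b using sym_group_inj[OF \<sigma>] by (auto simp: inj_def)
  have v: "move \<sigma> p y p = \<sigma> ?x" "move \<sigma> p y y = ?x" "move \<sigma> p y ?x = \<sigma> y"
    using * False unfolding move_def by simp_all
  have o: "move \<sigma> p y z = \<sigma> z" if "z \<notin> {p, y, ?x}" for z
    using that unfolding move_def by simp
  have "fixed_pts n (move \<sigma> p y) - fixed_pts n \<sigma>
      = (\<Sum>z\<in>{1..n}. of_bool (move \<sigma> p y z = z) - of_bool (\<sigma> z = z))"
    unfolding fixed_pts_def by (simp add: sum_subtractf)
  also have "\<dots> = (\<Sum>z\<in>{p, y, ?x}. of_bool (move \<sigma> p y z = z) - of_bool (\<sigma> z = z))"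
    using * o by (intro sum.mono_neutral_right) auto
  also have "\<dots> = of_bool (\<sigma> ?x = p) - of_bool (\<sigma> y = y)"
    using * False inj by (simp add: v)
  finally show ?thesis using False by simp
qed

text \<open>
  Up to the factor \<open>n\<^sup>2\<close> this compares the density \<open>d\<close> of the points in two-cycles with
  \<open>f (1 - f)\<close>, where \<open>f\<close> is the density of the fixed points.
\<close>

definition discrepancy :: "nat \<Rightarrow> (nat \<Rightarrow> nat) \<Rightarrow> real" where
  "discrepancy n \<sigma> = (real n - 2) * two_pts n \<sigma> - fixed_pts n \<sigma> * (real n - fixed_pts n \<sigma>)"

text \<open>
  A random move gains a fixed point when it takes apart a two-cycle and loses one when it inserts
  after a fixed point; the discrepancy is exactly the balance of the two.
\<close>

lemma sum_moves_fixed_pts: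
  assumes \<sigma>: "\<sigma> \<in> sym_group n"
  shows "(\<Sum>(p, y)\<in>moves n \<sigma>. fixed_pts n (move \<sigma> p y) - fixed_pts n \<sigma>) = discrepancy n \<sigma>"
proof -
  have inj: "\<sigma> a = \<sigma> b \<longleftrightarrow> a = b" for a b using sym_group_inj[OF \<sigma>] by (auto simp: inj_def)
  have inner: "(\<Sum>y\<in>{1..n} - {\<sigma> p}. if y = p then 0 else of_bool (\<sigma> (\<sigma> p) = p) - of_bool (\<sigma> y = y))
      = (real n - 2) * of_bool (\<sigma> (\<sigma> p) = p) - fixed_pts n \<sigma>" (is "?l = _")
    if p: "p \<in> {1..n}" "\<sigma> p \<noteq> p" for p
  proof -
    have x: "\<sigma> p \<in> {1..n}" using p sym_group_in[OF \<sigma>] by blast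
    have "n \<ge> 2" using p x by auto
    have "?l = (\<Sum>y\<in>{1..n} - {\<sigma> p} - {p}. of_bool (\<sigma> (\<sigma> p) = p) - of_bool (\<sigma> y = y))"
      using p by (intro sum.mono_neutral_cong_right) auto
    also have "\<dots> = (\<Sum>y\<in>{1..n} - {\<sigma> p} - {p}. of_bool (\<sigma> (\<sigma> p) = p))
        - (\<Sum>y\<in>{1..n} - {\<sigma> p} - {p}. of_bool (\<sigma> y = y))"
      by (rule sum_subtractf)
    also have "(\<Sum>y\<in>{1..n} - {\<sigma> p} - {p}. of_bool (\<sigma> (\<sigma> p) = p)) = (real n - 2) * of_bool (\<sigma> (\<sigma> p) = p)"
      using p x \<open>n \<ge> 2\<close> by (simp add: card_Diff_singleton)
    also have "(\<Sum>y\<in>{1..n} - {\<sigma> p} - {p}. of_bool (\<sigma> y = y)) = fixed_pts n \<sigma>"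
      unfolding fixed_pts_def using p inj by (intro sum.mono_neutral_left) auto
    finally show ?thesis .
  qed
  have S: "moves n \<sigma> = Sigma {p \<in> {1..n}. \<sigma> p \<noteq> p} (\<lambda>p. {1..n} - {\<sigma> p})"
    unfolding moves_def by auto
  have "(\<Sum>(p, y)\<in>moves n \<sigma>. fixed_pts n (move \<sigma> p y) - fixed_pts n \<sigma>)
      = (\<Sum>(p, y)\<in>moves n \<sigma>. if y = p then 0 else of_bool (\<sigma> (\<sigma> p) = p) - of_bool (\<sigma> y = y))"
    using fixed_pts_move[OF \<sigma>] by (intro sum.cong) auto
  also have "\<dots> = (\<Sum>p\<in>{p \<in> {1..n}. \<sigma> p \<noteq> p}.
      (\<Sum>y\<in>{1..n} - {\<sigma> p}. if y = p then 0 else of_bool (\<sigma> (\<sigma> p) = p) - of_bool (\<sigma> y = y)))"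
    unfolding S by (rule sum.Sigma[symmetric]) auto
  also have "\<dots> = (\<Sum>p\<in>{p \<in> {1..n}. \<sigma> p \<noteq> p}. (real n - 2) * of_bool (\<sigma> (\<sigma> p) = p) - fixed_pts n \<sigma>)"
    using inner by (intro sum.cong) auto
  also have "\<dots> = (\<Sum>p\<in>{1..n}. of_bool (\<sigma> p \<noteq> p) * ((real n - 2) * of_bool (\<sigma> (\<sigma> p) = p) - fixed_pts n \<sigma>))"
    by (intro sum.mono_neutral_cong_left) auto
  also have "\<dots> = (\<Sum>p\<in>{1..n}. (real n - 2) * of_bool (\<sigma> p \<noteq> p \<and> \<sigma> (\<sigma> p) = p)
      - fixed_pts n \<sigma> * (1 - of_bool (\<sigma> p = p)))"
    by (intro sum.cong) auto
  also have "\<dots> = discrepancy n \<sigma>"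
    unfolding discrepancy_def two_pts_def
    by (simp add: sum_subtractf flip: sum_distrib_left) (simp add: fixed_pts_def)
  finally show ?thesis .
qed

lemma discrepancy_move:
  assumes \<sigma>: "\<sigma> \<in> sym_group n" and m: "(p, y) \<in> moves n \<sigma>"
  shows "\<bar>fixed_pts n (move \<sigma> p y) - fixed_pts n \<sigma>\<bar> \<le> 1"
    "\<bar>discrepancy n (move \<sigma> p y) - discrepancy n \<sigma>\<bar> \<le> 9 * real n"
proof -
  let ?s = "move \<sigma> p y" and ?\<rho> = "\<sigma> \<circ> transposition p (\<sigma> p)"
  let ?F = "fixed_pts n \<sigma>" and ?F' = "fixed_pts n ?s"
  have *: "p \<in> {1..n}" "\<sigma> p \<in> {1..n}" "p \<noteq> \<sigma> p"
    using m sym_group_in[OF \<sigma>, of p] unfolding moves_def by auto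
  then have n2: "2 \<le> n" by auto
  have \<rho>: "?\<rho> \<in> sym_group n" using comp_transpose_in_sym_group \<sigma> * by blast
  show F: "\<bar>?F' - ?F\<bar> \<le> 1"
    unfolding fixed_pts_move[OF assms] by (simp add: of_bool_def)
  have "\<bar>two_pts n ?s - two_pts n \<sigma>\<bar> \<le> 8"
    using two_pts_transpose[OF \<sigma>, of p "\<sigma> p"] two_pts_transpose[OF \<rho>, of "\<sigma> p" y]
    unfolding move_def by linarith
  then have "(real n - 2) * \<bar>two_pts n ?s - two_pts n \<sigma>\<bar> \<le> real n * 8"
    using n2 by (intro mult_mono) auto
  then have D: "\<bar>(real n - 2) * (two_pts n ?s - two_pts n \<sigma>)\<bar> \<le> real n * 8"
    using n2 by (simp add: abs_mult)
  have "\<bar>?F' + ?F - n\<bar> \<le> n"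
    using fixed_pts_bounds[of n \<sigma>] fixed_pts_bounds[of n ?s] by linarith
  then have "\<bar>?F' - ?F\<bar> * \<bar>?F' + ?F - n\<bar> \<le> 1 * real n"
    using F by (intro mult_mono) auto
  then have Q: "\<bar>(?F' - ?F) * (?F' + ?F - n)\<bar> \<le> n" by (simp add: abs_mult)
  have "discrepancy n ?s - discrepancy n \<sigma>
      = (real n - 2) * (two_pts n ?s - two_pts n \<sigma>) + (?F' - ?F) * (?F' + ?F - n)"
    unfolding discrepancy_def by (simp add: algebra_simps)
  then show "\<bar>discrepancy n ?s - discrepancy n \<sigma>\<bar> \<le> 9 * real n" using D Q by linarith
qed

text \<open>
  The moves make the sphere an undirected graph. Summing by parts over its edges turns
  \<open>\<Sum> R \<Delta>F = \<Sum> R\<^sup>2\<close> into \<open>- \<Sum> \<Delta>R \<Delta>F / 2\<close>, in which both increments are small. So a typical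
  value of \<open>R\<close> is at most of order \<open>n\<^sup>3\<^sup>/\<^sup>2\<close>, which is small on the scale \<open>n\<^sup>2\<close> of its range.
\<close>

lemma sum_discrepancy_squared:
  assumes S: "S = {\<sigma> \<in> sym_group n. num_cycles n \<sigma> = N}"
  shows "(\<Sum>\<sigma>\<in>S. (discrepancy n \<sigma>)\<^sup>2) \<le> 5 * real n ^ 3 * card S"
proof -
  let ?R = "discrepancy n" and ?F = "fixed_pts n"
  define T where "T = Sigma S (moves n)"
  define r where "r = (\<lambda>(\<sigma>, p, y). (move \<sigma> p y, y, p))"
  have fS: "finite S" unfolding S using finite_sym_group by simp
  have fT: "finite T" unfolding T_def using fS finite_moves by blast
  have sub: "\<sigma> \<in> sym_group n" if "\<sigma> \<in> S" for \<sigma> using that S by simp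
  have r_in: "r t \<in> T" and r_r: "r (r t) = t" if "t \<in> T" for t
  proof -
    obtain \<sigma> p y where t: "t = (\<sigma>, p, y)" by (cases t)
    then have m: "\<sigma> \<in> S" "(p, y) \<in> moves n \<sigma>" using that unfolding T_def by auto
    have "move \<sigma> p y \<in> S"
      using move_in_sym_group[OF sub m(2)] num_cycles_move[OF sub m(2)] m(1)
      unfolding S mem_Collect_eq by metis
    then show "r t \<in> T" unfolding T_def r_def t using move_reverse(2)[OF m(2)] by simp
    show "r (r t) = t" unfolding r_def t using move_reverse(3)[OF m(2)] by simp
  qed
  define E where "E = (\<lambda>h. \<Sum>t\<in>T. h (fst t) (fst (r t)) :: real)"
  have swap: "E h = E (\<lambda>a b. h b a)" for h
    unfolding E_def by (rule sum.reindex_bij_witness[of _ r r]) (use r_in r_r in auto)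
  have eq: "E (\<lambda>a b. ?R a * (?F b - ?F a)) = (\<Sum>\<sigma>\<in>S. (?R \<sigma>)\<^sup>2)"
  proof -
    have "E (\<lambda>a b. ?R a * (?F b - ?F a))
        = (\<Sum>\<sigma>\<in>S. \<Sum>(p, y)\<in>moves n \<sigma>. ?R \<sigma> * (?F (move \<sigma> p y) - ?F \<sigma>))"
      unfolding E_def T_def r_def
      by (subst sum.Sigma) (use fS finite_moves in \<open>auto intro!: sum.cong\<close>)
    also have "\<dots> = (\<Sum>\<sigma>\<in>S. ?R \<sigma> * (\<Sum>(p, y)\<in>moves n \<sigma>. ?F (move \<sigma> p y) - ?F \<sigma>))"
      by (simp add: sum_distrib_left case_prod_unfold)
    also have "\<dots> = (\<Sum>\<sigma>\<in>S. (?R \<sigma>)\<^sup>2)"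
      using sum_moves_fixed_pts sub by (intro sum.cong) (auto simp: power2_eq_square)
    finally show ?thesis .
  qed
  have "2 * (\<Sum>\<sigma>\<in>S. (?R \<sigma>)\<^sup>2) =
      E (\<lambda>a b. ?R a * (?F b - ?F a)) + E (\<lambda>a b. ?R b * (?F a - ?F b))"
    using eq swap[of "\<lambda>a b. ?R a * (?F b - ?F a)"] by linarith
  also have "\<dots> = E (\<lambda>a b. (?R a - ?R b) * (?F b - ?F a))"
    unfolding E_def sum.distrib[symmetric] by (intro sum.cong) (auto simp: algebra_simps)
  also have "\<dots> \<le> (\<Sum>t\<in>T. 9 * real n)"
    unfolding E_def
  proof (rule sum_mono)
    fix t assume "t \<in> T"
    then obtain \<sigma> p y where t: "t = (\<sigma>, p, y)" "\<sigma> \<in> S" "(p, y) \<in> moves n \<sigma>"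
      unfolding T_def by auto
    have "(?R \<sigma> - ?R (move \<sigma> p y)) * (?F (move \<sigma> p y) - ?F \<sigma>)
        \<le> \<bar>?R (move \<sigma> p y) - ?R \<sigma>\<bar> * \<bar>?F (move \<sigma> p y) - ?F \<sigma>\<bar>"
      by (metis abs_ge_self abs_minus_commute abs_mult)
    also have "\<dots> \<le> (9 * real n) * 1"
      using discrepancy_move[OF sub t(3)] t(2) by (intro mult_mono) auto
    finally show "(?R (fst t) - ?R (fst (r t))) * (?F (fst (r t)) - ?F (fst t)) \<le> 9 * real n"
      unfolding t(1) r_def by simp
  qed
  also have "\<dots> = 9 * real n * card T" by simp
  also have "card T \<le> card S * (n * n)"
  proof -
    have "card T = (\<Sum>\<sigma>\<in>S. card (moves n \<sigma>))"
      unfolding T_def using fS finite_moves by (intro card_SigmaI) auto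
    also have "\<dots> \<le> (\<Sum>\<sigma>\<in>S. n * n)" by (intro sum_mono card_moves_le)
    finally show ?thesis by simp
  qed
  then have "9 * real n * card T \<le> 9 * real n * (card S * (n * n))"
    by (intro mult_left_mono) (simp_all del: of_nat_mult flip: of_nat_mult)
  finally have "2 * (\<Sum>\<sigma>\<in>S. (?R \<sigma>)\<^sup>2) \<le> 9 * (real n ^ 3 * card S)"
    by (simp add: power3_eq_cube algebra_simps)
  moreover have "0 \<le> real n ^ 3 * card S" by simp
  ultimately show ?thesis by linarith
qed

lemma card_negative_discrepancy:
  assumes S: "S = {\<sigma> \<in> sym_group n. num_cycles n \<sigma> = N}" and "0 < \<epsilon>" "0 < n"
  shows "real (card {\<sigma> \<in> S. discrepancy n \<sigma> \<le> - \<epsilon> * (real n)\<^sup>2}) \<le> 5 / (\<epsilon>\<^sup>2 * n) * card S"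
proof -
  let ?B = "{\<sigma> \<in> S. discrepancy n \<sigma> \<le> - \<epsilon> * (real n)\<^sup>2}"
  have fS: "finite S" unfolding S using finite_sym_group by simp
  have "(\<epsilon> * (real n)\<^sup>2)\<^sup>2 * card ?B = (\<Sum>\<sigma>\<in>?B. (\<epsilon> * (real n)\<^sup>2)\<^sup>2)" by simp
  also have "\<dots> \<le> (\<Sum>\<sigma>\<in>?B. (discrepancy n \<sigma>)\<^sup>2)"
  proof (rule sum_mono)
    fix \<sigma> assume "\<sigma> \<in> ?B"
    then have "\<epsilon> * (real n)\<^sup>2 \<le> - discrepancy n \<sigma>" by simp
    then have "(\<epsilon> * (real n)\<^sup>2)\<^sup>2 \<le> (- discrepancy n \<sigma>)\<^sup>2"
      using \<open>0 < \<epsilon>\<close> by (intro power_mono) auto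
    then show "(\<epsilon> * (real n)\<^sup>2)\<^sup>2 \<le> (discrepancy n \<sigma>)\<^sup>2" by simp
  qed
  also have "\<dots> \<le> (\<Sum>\<sigma>\<in>S. (discrepancy n \<sigma>)\<^sup>2)" using fS by (intro sum_mono2) auto
  also have "\<dots> \<le> 5 * real n ^ 3 * card S" by (rule sum_discrepancy_squared[OF S])
  finally have "(\<epsilon>\<^sup>2 * n * card ?B) * real n ^ 3 \<le> (5 * card S) * real n ^ 3"
    by (simp add: power_mult_distrib power2_eq_square power3_eq_cube algebra_simps)
  then have "\<epsilon>\<^sup>2 * n * card ?B \<le> 5 * card S"
    by (rule mult_right_le_imp_le) (use \<open>0 < n\<close> in simp)
  then show ?thesis using assms(2,3) by (simp add: field_simps)
qed

section \<open>One step of the walk\<close>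

definition step_avg :: "nat \<Rightarrow> ((nat \<Rightarrow> nat) \<Rightarrow> real) \<Rightarrow> real" where
  "step_avg n g = (\<Sum>\<tau>\<in>transpositions n. g \<tau>) / card (transpositions n)"

definition pairs :: "nat \<Rightarrow> (nat \<times> nat) set" where
  "pairs n = {(x, y). x \<in> {1..n} \<and> y \<in> {1..n} \<and> x \<noteq> y}"

lemma finite_pairs: "finite (pairs n)"
  by (rule finite_subset[of _ "{1..n} \<times> {1..n}"]) (auto simp: pairs_def)

lemma card_off_diagonal:
  assumes "finite A"
  shows "card {(x, y). x \<in> A \<and> y \<in> A \<and> x \<noteq> y} = card A * (card A - 1)"
proof -
  have "{(x, y). x \<in> A \<and> y \<in> A \<and> x \<noteq> y} = Sigma A (\<lambda>x. A - {x})" by auto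
  then show ?thesis using assms by (simp add: card_SigmaI)
qed

lemma card_pairs: "real (card (pairs n)) = real n * (real n - 1)"
  unfolding pairs_def by (subst card_off_diagonal) (cases n, auto simp: algebra_simps)

lemma finite_transpositions: "finite (transpositions n)"
  using finite_subset[OF transpositions_subset finite_sym_group] .

text \<open>Each transposition comes from exactly two ordered pairs.\<close>

lemma sum_pairs_transpositions:
  fixes g :: "(nat \<Rightarrow> nat) \<Rightarrow> real"
  shows "(\<Sum>(x, y)\<in>pairs n. g (transposition x y)) = 2 * (\<Sum>\<tau>\<in>transpositions n. g \<tau>)"
proof -
  let ?t = "\<lambda>(x, y). transposition x y"
  have "?t ` pairs n = transpositions n"
    unfolding pairs_def transpositions_def by force
  moreover have fiber: "(\<Sum>q\<in>{q \<in> pairs n. ?t q = \<tau>}. g \<tau>) = 2 * g \<tau>" if \<tau>: "\<tau> \<in> transpositions n" for \<tau>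
  proof -
    obtain x y where xy: "\<tau> = transposition x y" "x \<in> {1..n}" "y \<in> {1..n}" "x \<noteq> y"
      by (rule transpositionsE[OF \<tau>])
    have "u = x \<and> v = y \<or> u = y \<and> v = x" if "transposition u v = transposition x y" "u \<noteq> v" for u v
    proof -
      have "transposition x y u = v" "transposition x y v = u" using that(1)[symmetric] by simp_all
      then show ?thesis using that(2) by (auto simp: Transposition.transpose_def split: if_splits)
    qed
    then have "{q \<in> pairs n. ?t q = \<tau>} = {(x, y), (y, x)}"
      using xy unfolding pairs_def by (auto simp: Transposition.transpose_commute)
    then show ?thesis using xy(4) by simp
  qed
  ultimately have "(\<Sum>q\<in>pairs n. g (?t q)) = (\<Sum>\<tau>\<in>transpositions n. 2 * g \<tau>)"
    by (subst sum.image_gen[OF finite_pairs, where g = ?t]) (auto intro!: sum.cong simp flip: fiber)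
  then show ?thesis by (simp add: case_prod_unfold sum_distrib_left)
qed

lemma card_transpositions: "2 * real (card (transpositions n)) = real n * (real n - 1)"
  using sum_pairs_transpositions[of "\<lambda>_. 1" n] card_pairs[of n] by simp

lemma transpositions_nonempty:
  assumes "2 \<le> n"
  shows "transpositions n \<noteq> {}"
proof
  assume "transpositions n = {}"
  then have "real n * (real n - 1) = 0" using card_transpositions[of n] by simp
  then show False using assms by simp
qed

lemma step_avg_pairs:
  "step_avg n g = (\<Sum>(x, y)\<in>pairs n. g (transposition x y)) / (real n * (real n - 1))"
  unfolding step_avg_def sum_pairs_transpositions card_transpositions[symmetric] by simp

lemma step_avg_mono:
  assumes "\<And>\<tau>. \<tau> \<in> transpositions n \<Longrightarrow> g \<tau> \<le> h \<tau>"
  shows "step_avg n g \<le> step_avg n h"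
  unfolding step_avg_def using assms by (intro divide_right_mono sum_mono) auto

lemma step_avg_add: "step_avg n (\<lambda>\<tau>. g \<tau> + h \<tau>) = step_avg n g + step_avg n h"
  unfolding step_avg_def by (simp add: sum.distrib add_divide_distrib)

lemma step_avg_mult: "step_avg n (\<lambda>\<tau>. c * g \<tau>) = c * step_avg n g"
  unfolding step_avg_def by (simp flip: sum_distrib_left)

lemma step_avg_const:
  assumes "2 \<le> n"
  shows "step_avg n (\<lambda>\<tau>. c) = c"
  unfolding step_avg_def using transpositions_nonempty[OF assms] finite_transpositions by simp

text \<open>
  A step that moves a quantity \<open>g\<close> by at most \<open>B\<close> adds at most \<open>B\<^sup>2\<close> to its mean square distance
  from any \<open>c\<close>, on top of the square of the mean distance.
\<close>

lemma step_avg_square_le: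
  assumes n: "2 \<le> n" and B: "\<And>\<tau>. \<tau> \<in> transpositions n \<Longrightarrow> \<bar>g \<tau> - s\<bar> \<le> B"
  shows "step_avg n (\<lambda>\<tau>. (g \<tau> - c)\<^sup>2) \<le> (step_avg n g - c)\<^sup>2 + B\<^sup>2"
proof -
  let ?m = "step_avg n g"
  have "step_avg n (\<lambda>\<tau>. (g \<tau> - s)\<^sup>2) \<le> step_avg n (\<lambda>\<tau>. B\<^sup>2)"
  proof (rule step_avg_mono)
    fix \<tau> assume "\<tau> \<in> transpositions n"
    then have "\<bar>g \<tau> - s\<bar>\<^sup>2 \<le> B\<^sup>2" using B by (intro power_mono) auto
    then show "(g \<tau> - s)\<^sup>2 \<le> B\<^sup>2" by simp
  qed
  then have 1: "step_avg n (\<lambda>\<tau>. (g \<tau> - s)\<^sup>2) \<le> B\<^sup>2" using step_avg_const[OF n] by simp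
  have "(\<lambda>\<tau>. (g \<tau> - c)\<^sup>2) = (\<lambda>\<tau>. (g \<tau> - s)\<^sup>2 + (2 * (s - c) * g \<tau> + (c\<^sup>2 - s\<^sup>2)))"
    by (auto simp: power2_eq_square algebra_simps)
  then have "step_avg n (\<lambda>\<tau>. (g \<tau> - c)\<^sup>2)
      = step_avg n (\<lambda>\<tau>. (g \<tau> - s)\<^sup>2) + (2 * (s - c) * ?m + (c\<^sup>2 - s\<^sup>2))"
    using step_avg_const[OF n] by (simp add: step_avg_add step_avg_mult)
  also have "2 * (s - c) * ?m + (c\<^sup>2 - s\<^sup>2) = (?m - c)\<^sup>2 - (?m - s)\<^sup>2"
    by (simp add: power2_eq_square algebra_simps)
  finally show ?thesis using 1 zero_le_power2[of "?m - s"] by linarith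
qed

section \<open>Fixed points and two-cycles along the walk\<close>

lemma count_transpositions_one:
  assumes z: "z \<in> {1..n}" and p: "p \<in> {1..n}"
  shows "(\<Sum>(x, y)\<in>pairs n. of_bool (transposition x y z = p) :: real)
    = (if p = z then (real n - 1) * (real n - 2) else 2)"
proof -
  let ?A = "{(x, y) \<in> pairs n. transposition x y z = p}"
  have "(\<Sum>(x, y)\<in>pairs n. of_bool (transposition x y z = p) :: real) = card ?A"
    by (simp add: case_prod_unfold sum_of_bool_eq finite_pairs Int_def conj_commute)
  also have "\<dots> = (if p = z then (real n - 1) * (real n - 2) else 2)"
  proof (cases "p = z")
    case True
    have "?A = {(x, y). x \<in> {1..n} - {z} \<and> y \<in> {1..n} - {z} \<and> x \<noteq> y}"
      unfolding pairs_def using True by (auto simp: Transposition.transpose_def)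
    then have "card ?A = (n - 1) * (n - 1 - 1)"
      using z by (simp only: card_off_diagonal finite_Diff finite_atLeastAtMost) simp
    moreover have "1 \<le> n" using z by simp
    then have "real ((n - 1) * (n - 1 - 1)) = (real n - 1) * (real n - 2)"
      by (cases "n = 1") (auto simp: of_nat_diff)
    ultimately show ?thesis using True by simp
  next
    case False
    have "?A = {(z, p), (p, z)}"
      unfolding pairs_def using False z p by (auto simp: Transposition.transpose_def split: if_splits)
    then show ?thesis using False by simp
  qed
  finally show ?thesis .
qed

text \<open>
  A transposition moves both \<open>z\<close> and \<open>w\<close> only if it exchanges them. If it fixes exactly one of
  them, its value at the other one determines it.
\<close>

lemma count_transpositions_two:
  assumes z: "z \<in> {1..n}" "w \<in> {1..n}" "z \<noteq> w" and p: "p \<in> {1..n}" "q \<in> {1..n}" "p \<noteq> q"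
  shows "(\<Sum>(x, y)\<in>pairs n. of_bool (transposition x y z = p \<and> transposition x y w = q) :: real)
    = (real n - 2) * (real n - 3) * of_bool (p = z \<and> q = w) + 2 * of_bool (p = w \<and> q = z)
      + 2 * of_bool (p = z \<and> q \<noteq> w) + 2 * of_bool (q = w \<and> p \<noteq> z)"
proof -
  let ?A = "{(x, y) \<in> pairs n. transposition x y z = p \<and> transposition x y w = q}"
  have eq: "(\<Sum>(x, y)\<in>pairs n. of_bool (transposition x y z = p \<and> transposition x y w = q) :: real) = card ?A"
    by (simp add: case_prod_unfold sum_of_bool_eq finite_pairs Int_def conj_commute)
  consider (same) "p = z" "q = w" | (swap) "p = w" "q = z" | (first) "p = z" "q \<noteq> w"
    | (second) "q = w" "p \<noteq> z" | (none) "p \<noteq> z" "q \<noteq> w" "\<not> (p = w \<and> q = z)"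
    by blast
  then show ?thesis
  proof cases
    case same
    have "?A = {(x, y). x \<in> {1..n} - {z, w} \<and> y \<in> {1..n} - {z, w} \<and> x \<noteq> y}"
      unfolding pairs_def using same z by (auto simp: Transposition.transpose_def split: if_splits)
    moreover have "card ({1..n} - {z, w}) = n - 2" using z by (simp add: card_Diff_subset)
    ultimately have "card ?A = (n - 2) * (n - 2 - 1)"
      by (simp only: card_off_diagonal finite_Diff finite_atLeastAtMost)
    moreover have "2 \<le> n" using z by auto
    then have "real ((n - 2) * (n - 2 - 1)) = (real n - 2) * (real n - 3)"
      by (cases "n = 2") (auto simp: of_nat_diff)
    ultimately show ?thesis using same z p unfolding eq by simp
  next
    case swap
    have "?A = {(z, w), (w, z)}"
      unfolding pairs_def using swap z by (auto simp: Transposition.transpose_def split: if_splits)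
    then show ?thesis using swap z p unfolding eq by simp
  next
    case first
    have "?A = {(w, q), (q, w)}"
      unfolding pairs_def using first z p by (auto simp: Transposition.transpose_def split: if_splits)
    then show ?thesis using first z p unfolding eq by simp
  next
    case second
    have "?A = {(z, p), (p, z)}"
      unfolding pairs_def using second z p by (auto simp: Transposition.transpose_def split: if_splits)
    then show ?thesis using second z p unfolding eq by simp
  next
    case none
    have "?A = {}"
      unfolding pairs_def using none z p by (auto simp: Transposition.transpose_def split: if_splits)
    then have "card ?A = 0" by (simp only: card.empty)
    then show ?thesis unfolding eq using none by auto
  qed
qed

lemma sym_group_inv:
  assumes \<sigma>: "\<sigma> \<in> sym_group n"
  shows "inv \<sigma> z \<in> {1..n} \<longleftrightarrow> z \<in> {1..n}" "\<sigma> a = z \<longleftrightarrow> a = inv \<sigma> z"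
proof -
  have p: "\<sigma> permutes {1..n}" using \<sigma> unfolding sym_group_def by simp
  show "inv \<sigma> z \<in> {1..n} \<longleftrightarrow> z \<in> {1..n}"
    using permutes_in_image[OF permutes_inv[OF p]] .
  show "\<sigma> a = z \<longleftrightarrow> a = inv \<sigma> z"
    using permutes_inv_eq[OF p] by metis
qed

lemma sum_pairs_fixed_pts:
  assumes \<sigma>: "\<sigma> \<in> sym_group n"
  shows "(\<Sum>(x, y)\<in>pairs n. fixed_pts n (\<sigma> \<circ> transposition x y))
    = (real n - 1) * (real n - 2) * fixed_pts n \<sigma> + 2 * (real n - fixed_pts n \<sigma>)"
proof -
  have "(\<Sum>(x, y)\<in>pairs n. fixed_pts n (\<sigma> \<circ> transposition x y))
      = (\<Sum>z\<in>{1..n}. \<Sum>(x, y)\<in>pairs n. of_bool (transposition x y z = inv \<sigma> z))"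
    unfolding fixed_pts_def case_prod_unfold comp_apply sym_group_inv(2)[OF \<sigma>] by (rule sum.swap)
  also have "\<dots> = (\<Sum>z\<in>{1..n}. if inv \<sigma> z = z then (real n - 1) * (real n - 2) else 2)"
    using sym_group_inv(1)[OF \<sigma>] by (intro sum.cong refl count_transpositions_one) auto
  also have "\<dots> = (\<Sum>z\<in>{1..n}. (real n - 1) * (real n - 2) * of_bool (\<sigma> z = z)
      + 2 * (1 - of_bool (\<sigma> z = z)))"
    using sym_group_inv(2)[OF \<sigma>] by (intro sum.cong refl) (auto simp: of_bool_def)
  also have "\<dots> = (real n - 1) * (real n - 2) * fixed_pts n \<sigma> + 2 * (real n - fixed_pts n \<sigma>)"
    by (simp add: sum.distrib sum_subtractf fixed_pts_def flip: sum_distrib_left)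
  finally show ?thesis .
qed

lemma two_pts_pairs:
  assumes \<sigma>: "\<sigma> \<in> sym_group n"
  shows "two_pts n \<sigma> = (\<Sum>(z, w)\<in>pairs n. of_bool (\<sigma> z = w \<and> \<sigma> w = z))"
proof -
  have S: "pairs n = Sigma {1..n} (\<lambda>z. {1..n} - {z})" unfolding pairs_def by auto
  have "(\<Sum>(z, w)\<in>pairs n. of_bool (\<sigma> z = w \<and> \<sigma> w = z))
      = (\<Sum>z\<in>{1..n}. \<Sum>w\<in>{1..n} - {z}. of_bool (\<sigma> z = w \<and> \<sigma> w = z) :: real)"
    unfolding S by (rule sum.Sigma[symmetric]) auto
  also have "\<dots> = (\<Sum>z\<in>{1..n}. of_bool (\<sigma> z \<noteq> z \<and> \<sigma> (\<sigma> z) = z))"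
  proof (rule sum.cong[OF refl])
    fix z assume z: "z \<in> {1..n}"
    then have "\<sigma> z \<in> {1..n}" using sym_group_in[OF \<sigma>] by blast
    have "(\<Sum>w\<in>{1..n} - {z}. of_bool (\<sigma> z = w \<and> \<sigma> w = z) :: real)
        = (\<Sum>w\<in>{1..n} - {z}. if w = \<sigma> z then of_bool (\<sigma> (\<sigma> z) = z) else 0)"
      by (intro sum.cong) auto
    also have "\<dots> = of_bool (\<sigma> z \<noteq> z \<and> \<sigma> (\<sigma> z) = z)"
      using \<open>\<sigma> z \<in> {1..n}\<close> by (subst sum.delta) auto
    finally show "(\<Sum>w\<in>{1..n} - {z}. of_bool (\<sigma> z = w \<and> \<sigma> w = z) :: real)
        = of_bool (\<sigma> z \<noteq> z \<and> \<sigma> (\<sigma> z) = z)" .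
  qed
  finally show ?thesis unfolding two_pts_def by simp
qed

lemma sum_pairs_image_not_two:
  assumes \<sigma>: "\<sigma> \<in> sym_group n"
  shows "(\<Sum>(z, w)\<in>pairs n. of_bool (\<sigma> z = w \<and> \<sigma> w \<noteq> z)) = real n - fixed_pts n \<sigma> - two_pts n \<sigma>"
proof -
  have S: "pairs n = Sigma {1..n} (\<lambda>z. {1..n} - {z})" unfolding pairs_def by auto
  have "(\<Sum>(z, w)\<in>pairs n. of_bool (\<sigma> z = w \<and> \<sigma> w \<noteq> z))
      = (\<Sum>z\<in>{1..n}. \<Sum>w\<in>{1..n} - {z}. of_bool (\<sigma> z = w \<and> \<sigma> w \<noteq> z) :: real)"
    unfolding S by (rule sum.Sigma[symmetric]) auto
  also have "\<dots> = (\<Sum>z\<in>{1..n}. 1 - of_bool (\<sigma> z = z) - of_bool (\<sigma> z \<noteq> z \<and> \<sigma> (\<sigma> z) = z))"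
  proof (rule sum.cong[OF refl])
    fix z assume z: "z \<in> {1..n}"
    then have "\<sigma> z \<in> {1..n}" using sym_group_in[OF \<sigma>] by blast
    have "(\<Sum>w\<in>{1..n} - {z}. of_bool (\<sigma> z = w \<and> \<sigma> w \<noteq> z) :: real)
        = (\<Sum>w\<in>{1..n} - {z}. if w = \<sigma> z then of_bool (\<sigma> (\<sigma> z) \<noteq> z) else 0)"
      by (intro sum.cong) auto
    also have "\<dots> = 1 - of_bool (\<sigma> z = z) - of_bool (\<sigma> z \<noteq> z \<and> \<sigma> (\<sigma> z) = z)"
      using \<open>\<sigma> z \<in> {1..n}\<close> by (subst sum.delta) auto
    finally show "(\<Sum>w\<in>{1..n} - {z}. of_bool (\<sigma> z = w \<and> \<sigma> w \<noteq> z) :: real)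
        = 1 - of_bool (\<sigma> z = z) - of_bool (\<sigma> z \<noteq> z \<and> \<sigma> (\<sigma> z) = z)" .
  qed
  also have "\<dots> = real n - fixed_pts n \<sigma> - two_pts n \<sigma>"
    by (simp add: sum_subtractf fixed_pts_def two_pts_def)
  finally show ?thesis .
qed

lemma sum_pairs_both_fixed:
  "(\<Sum>(z, w)\<in>pairs n. of_bool (\<sigma> z = z \<and> \<sigma> w = w)) = fixed_pts n \<sigma> * (fixed_pts n \<sigma> - 1)"
proof -
  have S: "pairs n = Sigma {1..n} (\<lambda>z. {1..n} - {z})" unfolding pairs_def by auto
  have "(\<Sum>(z, w)\<in>pairs n. of_bool (\<sigma> z = z \<and> \<sigma> w = w))
      = (\<Sum>z\<in>{1..n}. \<Sum>w\<in>{1..n} - {z}. of_bool (\<sigma> z = z \<and> \<sigma> w = w) :: real)"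
    unfolding S by (rule sum.Sigma[symmetric]) auto
  also have "\<dots> = (\<Sum>z\<in>{1..n}. of_bool (\<sigma> z = z) * (fixed_pts n \<sigma> - 1))"
  proof (rule sum.cong[OF refl])
    fix z assume z: "z \<in> {1..n}"
    have "(\<Sum>w\<in>{1..n} - {z}. of_bool (\<sigma> z = z \<and> \<sigma> w = w) :: real)
        = of_bool (\<sigma> z = z) * (\<Sum>w\<in>{1..n} - {z}. of_bool (\<sigma> w = w))"
      by (simp add: sum_distrib_left of_bool_conj)
    also have "(\<Sum>w\<in>{1..n} - {z}. of_bool (\<sigma> w = w) :: real) = fixed_pts n \<sigma> - of_bool (\<sigma> z = z)"
      unfolding fixed_pts_def using z by (simp only: sum_diff1[OF finite_atLeastAtMost] if_True)
    also have "of_bool (\<sigma> z = z) * (fixed_pts n \<sigma> - of_bool (\<sigma> z = z))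
        = of_bool (\<sigma> z = z) * (fixed_pts n \<sigma> - 1)"
      by (cases "\<sigma> z = z") auto
    finally show "(\<Sum>w\<in>{1..n} - {z}. of_bool (\<sigma> z = z \<and> \<sigma> w = w) :: real)
        = of_bool (\<sigma> z = z) * (fixed_pts n \<sigma> - 1)" .
  qed
  also have "\<dots> = fixed_pts n \<sigma> * (fixed_pts n \<sigma> - 1)"
    unfolding sum_distrib_right[symmetric] by (simp add: fixed_pts_def)
  finally show ?thesis .
qed

lemma sum_pairs_swap:
  "(\<Sum>(z, w)\<in>pairs n. h z w) = (\<Sum>(z, w)\<in>pairs n. h w z :: real)"
  by (rule sum.reindex_bij_witness[of _ "\<lambda>(z, w). (w, z)" "\<lambda>(z, w). (w, z)"])
    (auto simp: pairs_def)

text \<open>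
  The points \<open>z\<close> and \<open>w\<close> form a two-cycle of \<open>\<sigma> \<circ> \<tau>\<close> if \<open>\<tau>\<close> takes them to the preimages of \<open>w\<close>
  and \<open>z\<close>. The three terms count the two-cycles of \<open>\<sigma>\<close> that are left alone, those made of two
  fixed points, and those split off from longer cycles.
\<close>

lemma sum_pairs_two_pts:
  assumes \<sigma>: "\<sigma> \<in> sym_group n"
  shows "(\<Sum>(x, y)\<in>pairs n. two_pts n (\<sigma> \<circ> transposition x y))
    = (real n - 2) * (real n - 3) * two_pts n \<sigma> + 2 * (fixed_pts n \<sigma> * (fixed_pts n \<sigma> - 1))
      + 4 * (real n - fixed_pts n \<sigma> - two_pts n \<sigma>)"
proof -
  let ?c = "(real n - 2) * (real n - 3)"
  have in_range: "x \<in> {1..n} \<and> y \<in> {1..n} \<and> x \<noteq> y" if "(x, y) \<in> pairs n" for x y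
    using that unfolding pairs_def by simp
  have "(\<Sum>(x, y)\<in>pairs n. two_pts n (\<sigma> \<circ> transposition x y))
      = (\<Sum>(x, y)\<in>pairs n. \<Sum>(z, w)\<in>pairs n.
          of_bool ((\<sigma> \<circ> transposition x y) z = w \<and> (\<sigma> \<circ> transposition x y) w = z))"
    using two_pts_pairs comp_transpose_in_sym_group[OF \<sigma>] in_range by (intro sum.cong) auto
  also have "\<dots> = (\<Sum>(z, w)\<in>pairs n. \<Sum>(x, y)\<in>pairs n.
      of_bool (transposition x y z = inv \<sigma> w \<and> transposition x y w = inv \<sigma> z))"
    unfolding case_prod_unfold comp_apply sym_group_inv(2)[OF \<sigma>] by (rule sum.swap)
  also have "\<dots> = (\<Sum>(z, w)\<in>pairs n. ?c * of_bool (\<sigma> z = w \<and> \<sigma> w = z) + 2 * of_bool (\<sigma> z = z \<and> \<sigma> w = w)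
      + 2 * of_bool (\<sigma> z = w \<and> \<sigma> w \<noteq> z) + 2 * of_bool (\<sigma> w = z \<and> \<sigma> z \<noteq> w))"
  proof (intro sum.cong refl, clarify)
    fix z w assume "(z, w) \<in> pairs n"
    then have zw: "z \<in> {1..n}" "w \<in> {1..n}" "z \<noteq> w" using in_range by auto
    have "inv \<sigma> w \<noteq> inv \<sigma> z" using zw(3) sym_group_inv(2)[OF \<sigma>] by metis
    then have "(\<Sum>(x, y)\<in>pairs n. of_bool (transposition x y z = inv \<sigma> w \<and> transposition x y w = inv \<sigma> z) :: real)
      = ?c * of_bool (inv \<sigma> w = z \<and> inv \<sigma> z = w) + 2 * of_bool (inv \<sigma> w = w \<and> inv \<sigma> z = z)
      + 2 * of_bool (inv \<sigma> w = z \<and> inv \<sigma> z \<noteq> w) + 2 * of_bool (inv \<sigma> z = w \<and> inv \<sigma> w \<noteq> z)"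
      using zw sym_group_inv(1)[OF \<sigma>] by (intro count_transpositions_two) auto
    moreover have "inv \<sigma> a = b \<longleftrightarrow> \<sigma> b = a" for a b using sym_group_inv(2)[OF \<sigma>] by metis
    ultimately show "(\<Sum>(x, y)\<in>pairs n. of_bool (transposition x y z = inv \<sigma> w \<and> transposition x y w = inv \<sigma> z) :: real)
      = ?c * of_bool (\<sigma> z = w \<and> \<sigma> w = z) + 2 * of_bool (\<sigma> z = z \<and> \<sigma> w = w)
      + 2 * of_bool (\<sigma> z = w \<and> \<sigma> w \<noteq> z) + 2 * of_bool (\<sigma> w = z \<and> \<sigma> z \<noteq> w)"
      by (simp add: conj_commute)
  qed
  also have "\<dots> = ?c * (\<Sum>(z, w)\<in>pairs n. of_bool (\<sigma> z = w \<and> \<sigma> w = z))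
      + 2 * (\<Sum>(z, w)\<in>pairs n. of_bool (\<sigma> z = z \<and> \<sigma> w = w))
      + 2 * (\<Sum>(z, w)\<in>pairs n. of_bool (\<sigma> z = w \<and> \<sigma> w \<noteq> z))
      + 2 * (\<Sum>(z, w)\<in>pairs n. of_bool (\<sigma> w = z \<and> \<sigma> z \<noteq> w))"
    by (simp only: case_prod_unfold sum.distrib sum_distrib_left)
  also have "(\<Sum>(z, w)\<in>pairs n. of_bool (\<sigma> w = z \<and> \<sigma> z \<noteq> w) :: real)
      = (\<Sum>(z, w)\<in>pairs n. of_bool (\<sigma> z = w \<and> \<sigma> w \<noteq> z))"
    by (rule sum_pairs_swap)
  finally show ?thesis
    unfolding two_pts_pairs[OF \<sigma>, symmetric] sum_pairs_both_fixed sum_pairs_image_not_two[OF \<sigma>]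
    by linarith
qed

text \<open>
  With \<open>j = t n / 2\<close> these are \<open>n e\<^sup>-\<^sup>t\<close> and \<open>n t e\<^sup>-\<^sup>2\<^sup>t\<close>, the numbers of isolated points and of
  points in isolated edges of a random graph with \<open>j\<close> edges. The powers of \<open>1 - 2 / n\<close> are chosen
  because they solve the recursions for the means up to an error of order \<open>1 / n\<close> in each step.
\<close>

definition fixed_curve :: "nat \<Rightarrow> nat \<Rightarrow> real" where
  "fixed_curve n j = real n * (1 - 2 / real n) ^ j"

definition two_curve :: "nat \<Rightarrow> nat \<Rightarrow> real" where
  "two_curve n j = 2 * real j * (1 - 2 / real n) ^ (2 * j - 2)"

lemma fixed_curve_Suc: "fixed_curve n (Suc j) = (1 - 2 / real n) * fixed_curve n j"
  unfolding fixed_curve_def by simp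

lemma two_curve_Suc:
  assumes "0 < n"
  shows "two_curve n (Suc j) = (1 - 2 / real n)\<^sup>2 * two_curve n j + 2 * (fixed_curve n j / real n)\<^sup>2"
proof -
  define r where "r = 1 - 2 / real n"
  have "r\<^sup>2 * (2 * real j * r ^ (2 * j - 2)) = 2 * real j * r ^ (2 * j)"
  proof (cases j)
    case (Suc i)
    then have "2 * j = 2 + (2 * j - 2)" by simp
    then have "r ^ (2 * j) = r\<^sup>2 * r ^ (2 * j - 2)" by (metis power_add)
    then show ?thesis by simp
  qed simp
  moreover have "(fixed_curve n j / real n)\<^sup>2 = r ^ (2 * j)"
    using assms unfolding fixed_curve_def r_def by (simp add: power_mult[symmetric] mult.commute)
  moreover have "two_curve n (Suc j) = 2 * real j * r ^ (2 * j) + 2 * r ^ (2 * j)"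
    by (simp add: two_curve_def r_def algebra_simps)
  ultimately show ?thesis
    unfolding two_curve_def[of n j] r_def[symmetric] by linarith
qed

lemma curve_bounds:
  assumes "2 \<le> n"
  shows "0 \<le> fixed_curve n j" "fixed_curve n j \<le> n" "0 \<le> two_curve n j" "two_curve n j \<le> n"
proof -
  let ?r = "1 - 2 / real n"
  have r: "0 \<le> ?r" "?r \<le> 1" using assms by (auto simp: field_simps)
  show f0: "0 \<le> fixed_curve n j" for j using r unfolding fixed_curve_def by simp
  show f1: "fixed_curve n j \<le> n" for j
    using r unfolding fixed_curve_def by (simp add: mult_left_le power_le_one)
  show "0 \<le> two_curve n j" for j using r unfolding two_curve_def by simp
  show "two_curve n j \<le> n"
  proof (induct j)
    case 0
    then show ?case by (simp add: two_curve_def)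
  next
    case (Suc j)
    have "(fixed_curve n j / n)\<^sup>2 \<le> 1"
      using f0[of j] f1[of j] assms by (intro power_le_one) auto
    moreover have "?r\<^sup>2 * two_curve n j \<le> ?r * n"
      using r Suc \<open>\<And>j. 0 \<le> two_curve n j\<close>
      by (intro mult_mono) (auto simp: power2_eq_square mult_left_le)
    ultimately have "two_curve n (Suc j) \<le> ?r * n + 2"
      using two_curve_Suc[of n j] assms by simp
    also have "\<dots> = n" using assms by (simp add: field_simps)
    finally show ?case .
  qed
qed

definition curve_error :: "nat \<Rightarrow> nat \<Rightarrow> (nat \<Rightarrow> nat) \<Rightarrow> real" where
  "curve_error n j \<sigma> = (fixed_pts n \<sigma> - fixed_curve n j)\<^sup>2 + (two_pts n \<sigma> - two_curve n j)\<^sup>2"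

lemma step_avg_fixed_pts:
  assumes "2 \<le> n" "\<sigma> \<in> sym_group n"
  shows "step_avg n (\<lambda>\<tau>. fixed_pts n (\<sigma> \<circ> \<tau>))
    = fixed_pts n \<sigma> + 2 * (1 - fixed_pts n \<sigma>) / (real n - 1)"
proof -
  let ?N = "real n" and ?F = "fixed_pts n \<sigma>"
  have N: "?N - 1 \<noteq> 0" "?N \<noteq> 0" using assms(1) by auto
  have "(?N - 1) * (?N - 2) * ?F + 2 * (?N - ?F) = ?N * (?N - 1) * ?F + ?N * (2 * (1 - ?F))"
    by (simp add: algebra_simps)
  then show ?thesis
    unfolding step_avg_pairs sum_pairs_fixed_pts[OF assms(2)]
    using N by (simp add: add_divide_distrib)
qed

lemma fixed_pts_mean_error:
  assumes n: "2 \<le> n" and \<sigma>: "\<sigma> \<in> sym_group n"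
  shows "(step_avg n (\<lambda>\<tau>. fixed_pts n (\<sigma> \<circ> \<tau>)) - fixed_curve n (Suc j))\<^sup>2
    \<le> (fixed_pts n \<sigma> - fixed_curve n j)\<^sup>2 + 12"
proof -
  let ?F = "fixed_pts n \<sigma>" and ?f = "fixed_curve n j" and ?N = "real n"
  let ?r = "2 / (?N - 1) - 2 * ?F / (?N * (?N - 1))"
  have N: "2 \<le> ?N" using n by simp
  have F: "0 \<le> ?F" "?F \<le> ?N" using fixed_pts_bounds by auto
  have f: "0 \<le> ?f" "?f \<le> ?N" using curve_bounds[OF n] by auto
  have eq: "step_avg n (\<lambda>\<tau>. fixed_pts n (\<sigma> \<circ> \<tau>)) - fixed_curve n (Suc j)
      = (1 - 2 / ?N) * (?F - ?f) + ?r"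
  proof -
    have "?N - 1 \<noteq> 0" "?N \<noteq> 0" using N by auto
    then have "2 * ?F / (?N - 1) = 2 * ?F / ?N + 2 * ?F / (?N * (?N - 1))"
      by (simp add: divide_simps) (simp add: algebra_simps)
    then show ?thesis
      unfolding step_avg_fixed_pts[OF assms] fixed_curve_Suc
      by (simp add: algebra_simps diff_divide_distrib)
  qed
  have r: "0 \<le> ?r" "?r \<le> 2 / (?N - 1)"
  proof -
    have "2 * ?F / (?N * (?N - 1)) = 2 / (?N - 1) * (?F / ?N)"
      by (simp only: times_divide_times_eq mult.commute[of ?N])
    then have "?r = 2 / (?N - 1) * (1 - ?F / ?N)" by (simp only: right_diff_distrib mult_1_right)
    moreover have "0 \<le> 1 - ?F / ?N" "1 - ?F / ?N \<le> 1" using N F by auto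
    moreover have "0 \<le> 2 / (?N - 1)" using N by simp
    ultimately show "0 \<le> ?r" "?r \<le> 2 / (?N - 1)"
      by (metis mult_nonneg_nonneg, metis mult_left_le)
  qed
  moreover have "2 / (?N - 1) \<le> 4 / ?N" using N by (simp add: field_simps)
  ultimately have r4: "\<bar>?r\<bar> \<le> 4 / ?N" by linarith
  have "4 / ?N \<le> 2" using N by (simp add: field_simps)
  then have r2: "\<bar>?r\<bar> \<le> 2" using r4 by linarith
  have "\<bar>(1 - 2 / ?N) * (?F - ?f)\<bar> \<le> 1 * \<bar>?F - ?f\<bar>"
    unfolding abs_mult using N by (intro mult_right_mono) (auto simp: field_simps)
  then have "\<bar>(1 - 2 / ?N) * (?F - ?f) + ?r\<bar> \<le> \<bar>?F - ?f\<bar> + \<bar>?r\<bar>"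
    by (intro order_trans[OF abs_triangle_ineq] add_right_mono) simp
  then have "((1 - 2 / ?N) * (?F - ?f) + ?r)\<^sup>2 \<le> (\<bar>?F - ?f\<bar> + \<bar>?r\<bar>)\<^sup>2"
    by (metis abs_ge_zero power2_abs power_mono)
  also have "\<dots> = (?F - ?f)\<^sup>2 + 2 * (\<bar>?F - ?f\<bar> * \<bar>?r\<bar>) + ?r\<^sup>2"
    by (simp add: power2_sum)
  also have "\<bar>?F - ?f\<bar> * \<bar>?r\<bar> \<le> ?N * (4 / ?N)"
    using F f r4 by (intro mult_mono) auto
  also have "?N * (4 / ?N) = 4" using N by simp
  also have "?r\<^sup>2 \<le> 2\<^sup>2" using r2 by (metis abs_ge_zero power2_abs power_mono)
  finally show ?thesis unfolding eq by simp
qed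

text \<open>
  In the difference of the means, the terms that come from comparing \<open>n (n - 1)\<close> with \<open>n\<^sup>2\<close> and
  from split cycles are of order \<open>1 / n\<close>. The only other one besides the contraction is
  \<open>2 (F\<^sup>2 - f\<^sup>2) / n\<^sup>2\<close>, which the deviation of the fixed points controls; this is why both
  deviations enter one quantity.
\<close>

lemma two_pts_mean_error:
  assumes n: "5 \<le> n" and \<sigma>: "\<sigma> \<in> sym_group n"
  shows "(step_avg n (\<lambda>\<tau>. two_pts n (\<sigma> \<circ> \<tau>)) - two_curve n (Suc j))\<^sup>2
    \<le> (two_pts n \<sigma> - two_curve n j)\<^sup>2 + 8 / real n * curve_error n j \<sigma> + 1352"
proof -
  let ?F = "fixed_pts n \<sigma>" and ?f = "fixed_curve n j" and ?N = "real n"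
  let ?D = "two_pts n \<sigma>" and ?u = "two_curve n j"
  let ?Y = "\<bar>?F - ?f\<bar>" and ?Z = "\<bar>?D - ?u\<bar>"
  have N: "5 \<le> ?N" using n by simp
  have F: "0 \<le> ?F" "?F \<le> ?N" using fixed_pts_bounds by auto
  have D: "0 \<le> ?D" "?D \<le> ?N" using two_pts_bounds by auto
  have fu: "0 \<le> ?f" "?f \<le> ?N" "0 \<le> ?u" "?u \<le> ?N" using curve_bounds[of n] n by auto
  define M where "M = ?N * (?N - 1)"
  have M: "0 < M" unfolding M_def using N by simp
  define \<alpha> where "\<alpha> = ((?N - 2) * (?N - 3) - 4) / M"
  have mean: "step_avg n (\<lambda>\<tau>. two_pts n (\<sigma> \<circ> \<tau>)) = \<alpha> * ?D + 2 / M * ?F\<^sup>2 + (4 * (?N - ?F) - 2 * ?F) / M"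
    unfolding step_avg_pairs sum_pairs_two_pts[OF \<sigma>] M_def[symmetric] \<alpha>_def
    using M by (simp add: field_simps power2_eq_square)
  have eq: "step_avg n (\<lambda>\<tau>. two_pts n (\<sigma> \<circ> \<tau>)) - two_curve n (Suc j)
      = \<alpha> * (?D - ?u) + (\<alpha> - (1 - 2 / ?N)\<^sup>2) * ?u + 2 / M * ((?F + ?f) * (?F - ?f))
        + (2 / M - 2 / ?N\<^sup>2) * ?f\<^sup>2 + (4 * (?N - ?F) - 2 * ?F) / M"
    using two_curve_Suc[of n j] n unfolding mean
    by (simp add: algebra_simps power2_eq_square)
  have "0 \<le> (?N - 2) * (?N - 3) - 4"
  proof -
    have "3 * 2 \<le> (?N - 2) * (?N - 3)" using N by (intro mult_mono) auto
    then show ?thesis by simp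
  qed
  moreover have "(?N - 2) * (?N - 3) - 4 \<le> M" unfolding M_def using N by (simp add: algebra_simps)
  ultimately have \<alpha>: "0 \<le> \<alpha>" "\<alpha> \<le> 1" unfolding \<alpha>_def using M by auto
  have t1: "\<bar>\<alpha> * (?D - ?u)\<bar> \<le> ?Z"
    using \<alpha> by (simp add: abs_mult mult_left_le_one_le)
  have nM: "?N / M = 1 / (?N - 1)" unfolding M_def using N by simp
  have i1: "1 / (?N - 1) \<le> 2 / ?N" using N by (simp add: field_simps)
  have t2: "\<bar>(\<alpha> - (1 - 2 / ?N)\<^sup>2) * ?u\<bar> \<le> 12 / ?N"
  proof -
    have "\<alpha> - (1 - 2 / ?N)\<^sup>2 = (4 - 6 * ?N) / (?N * M)"
      unfolding \<alpha>_def M_def using N by (simp add: field_simps power2_eq_square)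
    moreover have "\<bar>4 - 6 * ?N\<bar> \<le> 6 * ?N" using N by simp
    ultimately have "\<bar>\<alpha> - (1 - 2 / ?N)\<^sup>2\<bar> \<le> 6 * ?N / (?N * M)"
      using M N by (simp only: abs_divide) (intro divide_mono, auto)
    also have "\<dots> = 6 / M" using N by simp
    finally have "\<bar>\<alpha> - (1 - 2 / ?N)\<^sup>2\<bar> \<le> 6 / M" .
    then have "\<bar>(\<alpha> - (1 - 2 / ?N)\<^sup>2) * ?u\<bar> \<le> 6 / M * ?N"
      unfolding abs_mult using fu M by (intro mult_mono) auto
    then show ?thesis using nM i1 by simp
  qed
  have t3: "\<bar>2 / M * ((?F + ?f) * (?F - ?f))\<bar> \<le> 8 / ?N * ?Y"
  proof -
    have "\<bar>2 / M * ((?F + ?f) * (?F - ?f))\<bar> = (2 / M * (?F + ?f)) * ?Y"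
      using M F fu by (simp add: abs_mult)
    also have "\<dots> \<le> (2 / M * (2 * ?N)) * ?Y"
      using M F fu by (intro mult_right_mono mult_left_mono) auto
    also have "2 / M * (2 * ?N) = 4 * (?N / M)" by simp
    also have "4 * (?N / M) * ?Y \<le> 8 / ?N * ?Y"
      unfolding nM using i1 by (intro mult_right_mono) auto
    finally show ?thesis .
  qed
  have t4: "\<bar>(2 / M - 2 / ?N\<^sup>2) * ?f\<^sup>2\<bar> \<le> 4 / ?N"
  proof -
    have e: "2 / M - 2 / ?N\<^sup>2 = 2 / (?N\<^sup>2 * (?N - 1))"
      unfolding M_def using N by (simp add: field_simps power2_eq_square)
    have "?f\<^sup>2 \<le> ?N\<^sup>2" using fu by (intro power_mono)
    then have "2 / (?N\<^sup>2 * (?N - 1)) * ?f\<^sup>2 \<le> 2 / (?N\<^sup>2 * (?N - 1)) * ?N\<^sup>2"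
      using N by (intro mult_left_mono) auto
    also have "\<dots> = 2 * (1 / (?N - 1))" using N by simp
    also have "\<dots> \<le> 4 / ?N" using i1 by simp
    finally show ?thesis unfolding e using N by simp
  qed
  have t5: "\<bar>(4 * (?N - ?F) - 2 * ?F) / M\<bar> \<le> 12 / ?N"
  proof -
    have "\<bar>4 * (?N - ?F) - 2 * ?F\<bar> \<le> 6 * ?N"
      using F by (auto simp: abs_le_iff)
    then have "\<bar>(4 * (?N - ?F) - 2 * ?F) / M\<bar> \<le> 6 * ?N / M" using M by (simp add: divide_right_mono)
    then show ?thesis using nM i1 by simp
  qed
  define e where "e = 8 / ?N * ?Y + 28 / ?N"
  have "\<bar>step_avg n (\<lambda>\<tau>. two_pts n (\<sigma> \<circ> \<tau>)) - two_curve n (Suc j)\<bar> \<le> ?Z + e"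
    unfolding eq e_def using t1 t2 t3 t4 t5 by linarith
  then have "(step_avg n (\<lambda>\<tau>. two_pts n (\<sigma> \<circ> \<tau>)) - two_curve n (Suc j))\<^sup>2 \<le> (?Z + e)\<^sup>2"
    by (metis abs_ge_zero power2_abs power_mono)
  also have "\<dots> = ?Z\<^sup>2 + 2 * (?Z * e) + e\<^sup>2" by (simp add: power2_sum)
  also have "2 * (?Z * e) \<le> 8 / ?N * (?Y\<^sup>2 + ?Z\<^sup>2) + 56"
  proof -
    have "2 * (?Z * ?Y) \<le> ?Y\<^sup>2 + ?Z\<^sup>2" using sum_squares_bound[of ?Z ?Y] by linarith
    then have "8 / ?N * (2 * (?Z * ?Y)) \<le> 8 / ?N * (?Y\<^sup>2 + ?Z\<^sup>2)"
      using N by (intro mult_left_mono) auto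
    moreover have "?Z * (56 / ?N) \<le> ?N * (56 / ?N)"
      using D fu N by (intro mult_right_mono) auto
    then have "?Z * (56 / ?N) \<le> 56" using N by simp
    moreover have "2 * (?Z * e) = 8 / ?N * (2 * (?Z * ?Y)) + ?Z * (56 / ?N)"
      unfolding e_def by (simp add: algebra_simps)
    ultimately show ?thesis by linarith
  qed
  also have "e\<^sup>2 \<le> 1296"
  proof -
    have "8 / ?N * ?Y \<le> 8 / ?N * ?N" using F fu N by (intro mult_left_mono) auto
    then have "8 / ?N * ?Y \<le> 8" using N by simp
    moreover have "28 / ?N \<le> 28" using N by (simp add: field_simps)
    ultimately have "e \<le> 36" unfolding e_def by linarith
    moreover have "0 \<le> e" unfolding e_def by simp
    ultimately have "e\<^sup>2 \<le> 36\<^sup>2" by (intro power_mono)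
    then show ?thesis by simp
  qed
  finally show ?thesis unfolding curve_error_def by simp
qed

text \<open>
  Over \<open>C n\<close> steps the factors multiply to at most \<open>e\<^sup>8\<^sup>C\<close>, so the squared deviations, which could
  be of order \<open>n\<^sup>2\<close>, stay of order \<open>n\<close> on average.
\<close>

lemma step_avg_curve_error:
  assumes n: "5 \<le> n" and \<sigma>: "\<sigma> \<in> sym_group n"
  shows "step_avg n (\<lambda>\<tau>. curve_error n (Suc j) (\<sigma> \<circ> \<tau>)) \<le> (1 + 8 / real n) * curve_error n j \<sigma> + 1400"
proof -
  have n2: "2 \<le> n" using n by simp
  have *: "\<bar>fixed_pts n (\<sigma> \<circ> \<tau>) - fixed_pts n \<sigma>\<bar> \<le> 2" "\<bar>two_pts n (\<sigma> \<circ> \<tau>) - two_pts n \<sigma>\<bar> \<le> 4"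
    if \<tau>: "\<tau> \<in> transpositions n" for \<tau>
  proof -
    obtain x y where xy: "\<tau> = transposition x y" by (rule transpositionsE[OF \<tau>])
    show "\<bar>fixed_pts n (\<sigma> \<circ> \<tau>) - fixed_pts n \<sigma>\<bar> \<le> 2" unfolding xy by (rule fixed_pts_transpose)
    show "\<bar>two_pts n (\<sigma> \<circ> \<tau>) - two_pts n \<sigma>\<bar> \<le> 4" unfolding xy by (rule two_pts_transpose[OF \<sigma>])
  qed
  have "step_avg n (\<lambda>\<tau>. (fixed_pts n (\<sigma> \<circ> \<tau>) - fixed_curve n (Suc j))\<^sup>2)
      \<le> (fixed_pts n \<sigma> - fixed_curve n j)\<^sup>2 + 12 + 2\<^sup>2"
    using step_avg_square_le[where g = "\<lambda>\<tau>. fixed_pts n (\<sigma> \<circ> \<tau>)" and c = "fixed_curve n (Suc j)",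
        OF n2 *(1)]
      fixed_pts_mean_error[OF n2 \<sigma>, of j] by linarith
  moreover have "step_avg n (\<lambda>\<tau>. (two_pts n (\<sigma> \<circ> \<tau>) - two_curve n (Suc j))\<^sup>2)
      \<le> (two_pts n \<sigma> - two_curve n j)\<^sup>2 + 8 / real n * curve_error n j \<sigma> + 1352 + 4\<^sup>2"
    using step_avg_square_le[where g = "\<lambda>\<tau>. two_pts n (\<sigma> \<circ> \<tau>)" and c = "two_curve n (Suc j)",
        OF n2 *(2)]
      two_pts_mean_error[OF n \<sigma>, of j] by linarith
  ultimately show ?thesis
    unfolding curve_error_def[of n "Suc j"] step_avg_add
    by (simp add: curve_error_def algebra_simps)
qed

section \<open>Short cycles along the walk\<close>

definition short_cycles :: "nat \<Rightarrow> nat \<Rightarrow> (nat \<Rightarrow> nat) \<Rightarrow> nat" where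
  "short_cycles n L \<sigma> = card {B \<in> cycle_sets n \<sigma>. card B \<le> L}"

lemma short_cycles_le: "short_cycles n L \<sigma> \<le> n"
proof -
  have "short_cycles n L \<sigma> \<le> num_cycles n \<sigma>"
    unfolding short_cycles_def num_cycles_def by (intro card_mono finite_cycle_sets) auto
  then show ?thesis using num_cycles_le[of n \<sigma>] by linarith
qed

lemma finite_cycle:
  assumes "\<sigma> \<in> sym_group n" "B \<in> cycle_sets n \<sigma>"
  shows "finite B" "B \<subseteq> {1..n}"
proof -
  show "B \<subseteq> {1..n}" using assms orbit_subset_sym unfolding cycle_sets_def by blast
  then show "finite B" by (rule finite_subset) simp
qed

lemma num_cycles_le_short:
  assumes \<sigma>: "\<sigma> \<in> sym_group n" and L: "0 < L"
  shows "real (num_cycles n \<sigma>) \<le> short_cycles n L \<sigma> + real n / L"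
proof -
  let ?C = "cycle_sets n \<sigma>"
  let ?S = "{B \<in> ?C. card B \<le> L}" and ?T = "{B \<in> ?C. L < card B}"
  have "disjnt A B" if "A \<in> ?C" "B \<in> ?C" "A \<noteq> B" for A B
    using that orbit_eq_sym[OF \<sigma>] unfolding cycle_sets_def disjnt_def by blast
  then have disj: "pairwise disjnt ?T" by (auto simp: pairwise_def)
  have "card ?T * L \<le> (\<Sum>B\<in>?T. card B)"
    using sum_mono[of ?T "\<lambda>_. L" card] by simp
  also have "\<dots> = card (\<Union> ?T)"
    using disj finite_cycle(1)[OF \<sigma>] by (intro card_Union_disjoint[symmetric]) auto
  also have "\<dots> \<le> card {1..n}"
    using finite_cycle(2)[OF \<sigma>] by (intro card_mono) auto
  finally have "card ?T * L \<le> n" by simp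
  then have "real (card ?T) * L \<le> n" by (simp flip: of_nat_mult)
  then have "real (card ?T) \<le> real n / L" using L by (simp add: field_simps)
  moreover have "num_cycles n \<sigma> = card ?S + card ?T"
    unfolding num_cycles_def
    by (subst card_Un_disjoint[symmetric]) (auto simp: finite_cycle_sets intro!: arg_cong[of _ _ card])
  ultimately show ?thesis unfolding short_cycles_def by simp
qed

lemma short_cycles_merge:
  assumes \<sigma>: "\<sigma> \<in> sym_group n" and x: "x \<in> {1..n}" and y: "y \<in> {1..n}"
    and xy: "y \<notin> orbit \<sigma> x"
  shows "short_cycles n L (\<sigma> \<circ> transposition x y) + of_bool (card (orbit \<sigma> x) \<le> L) \<le> short_cycles n L \<sigma>"
proof -
  let ?X = "orbit \<sigma> x" and ?Y = "orbit \<sigma> y"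
  let ?S = "{B \<in> cycle_sets n \<sigma>. card B \<le> L}"
  let ?S' = "{B \<in> cycle_sets n (\<sigma> \<circ> transposition x y). card B \<le> L}"
  have fS: "finite ?S" using finite_cycle_sets by simp
  have C: "?X \<in> cycle_sets n \<sigma>" "?Y \<in> cycle_sets n \<sigma>" using x y unfolding cycle_sets_def by auto
  have ne: "?X \<noteq> ?Y" using xy self_in_orbit_sym[OF \<sigma>] by blast
  have fin: "finite (?X \<union> ?Y)" using C finite_cycle(1)[OF \<sigma>] by blast
  have le: "card ?X \<le> card (?X \<union> ?Y)" "card ?Y \<le> card (?X \<union> ?Y)"
    using fin by (auto intro!: card_mono)
  note eq = cycle_sets_merge[OF assms]
  consider "L < card ?X" | "card ?X \<le> L" "L < card (?X \<union> ?Y)" | "card (?X \<union> ?Y) \<le> L"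
    by linarith
  then show ?thesis
  proof cases
    case 1
    then have "?S' \<subseteq> ?S" unfolding eq using le by auto
    then show ?thesis unfolding short_cycles_def using 1 fS by (simp add: card_mono)
  next
    case 2
    then have "?S' \<subseteq> ?S - {?X}" unfolding eq using le by auto
    then have "card ?S' \<le> card (?S - {?X})" using fS by (intro card_mono) auto
    also have "\<dots> < card ?S" using 2 C fS by (intro psubset_card_mono) auto
    finally show ?thesis unfolding short_cycles_def using 2 by simp
  next
    case 3
    then have XY: "{?X, ?Y} \<subseteq> ?S" using C le by auto
    have "?S' \<subseteq> insert (?X \<union> ?Y) (?S - {?X, ?Y})" unfolding eq by auto
    then have "card ?S' \<le> card (insert (?X \<union> ?Y) (?S - {?X, ?Y}))" using fS by (intro card_mono) auto
    also have "\<dots> \<le> Suc (card (?S - {?X, ?Y}))" by (rule card_insert_le_m1) auto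
    also have "card (?S - {?X, ?Y}) = card ?S - 2" using XY ne fS by (simp add: card_Diff_subset)
    finally have "card ?S' \<le> Suc (card ?S - 2)" .
    moreover have "2 \<le> card ?S" using card_mono[OF fS XY] ne by simp
    ultimately show ?thesis unfolding short_cycles_def using 3 le by simp
  qed
qed

lemma short_cycles_split:
  assumes \<sigma>: "\<sigma> \<in> sym_group n" and x: "x \<in> {1..n}" and y: "y \<in> {1..n}"
    and xy: "x \<noteq> y" "y \<in> orbit \<sigma> x"
  shows "short_cycles n L (\<sigma> \<circ> transposition x y) \<le> short_cycles n L \<sigma>
    + of_bool (card (orbit (\<sigma> \<circ> transposition x y) x) \<le> L)
    + of_bool (card (orbit (\<sigma> \<circ> transposition x y) y) \<le> L)"
proof -
  let ?s = "\<sigma> \<circ> transposition x y"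
  let ?X = "orbit ?s x" and ?Y = "orbit ?s y"
  let ?S = "{B \<in> cycle_sets n \<sigma>. card B \<le> L}" and ?S' = "{B \<in> cycle_sets n ?s. card B \<le> L}"
  have s: "?s \<in> sym_group n" using comp_transpose_in_sym_group[OF \<sigma> x y] .
  have "y \<notin> ?X" using orbit_split[OF \<sigma> xy] by blast
  then have "cycle_sets n \<sigma> = insert (?X \<union> ?Y) (cycle_sets n ?s - {?X, ?Y})"
    using cycle_sets_merge[OF s x y] unfolding comp_transpose_twice by blast
  then have "?S' \<subseteq> ?S \<union> ({B. B = ?X \<and> card ?X \<le> L} \<union> {B. B = ?Y \<and> card ?Y \<le> L})" by auto
  then have "card ?S' \<le> card (?S \<union> ({B. B = ?X \<and> card ?X \<le> L} \<union> {B. B = ?Y \<and> card ?Y \<le> L}))"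
    using finite_cycle_sets by (intro card_mono) auto
  also have "\<dots> \<le> card ?S + (card {B. B = ?X \<and> card ?X \<le> L} + card {B. B = ?Y \<and> card ?Y \<le> L})"
    by (intro order_trans[OF card_Un_le] add_left_mono card_Un_le)
  also have "card {B. B = ?X \<and> card ?X \<le> L} = of_bool (card ?X \<le> L)"
    by (cases "card ?X \<le> L") auto
  also have "card {B. B = ?Y \<and> card ?Y \<le> L} = of_bool (card ?Y \<le> L)"
    by (cases "card ?Y \<le> L") auto
  finally show ?thesis unfolding short_cycles_def by (simp only: add.assoc)
qed

lemma card_short_splits:
  assumes \<sigma>: "\<sigma> \<in> sym_group n"
  shows "card {(x, y) \<in> pairs n. y \<in> orbit \<sigma> x \<and> card (orbit (\<sigma> \<circ> transposition x y) x) \<le> L} \<le> n * L"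
proof -
  let ?A = "{(x, y) \<in> pairs n. y \<in> orbit \<sigma> x \<and> card (orbit (\<sigma> \<circ> transposition x y) x) \<le> L}"
  let ?f = "\<lambda>(x, i). (x, inv (\<sigma> ^^ i) x)"
  have "?A \<subseteq> ?f ` ({1..n} \<times> {1..L})"
  proof
    fix q assume "q \<in> ?A"
    then obtain x y where q: "q = (x, y)" "x \<in> {1..n}" "x \<noteq> y" "y \<in> orbit \<sigma> x"
      "card (orbit (\<sigma> \<circ> transposition x y) x) \<le> L"
      unfolding pairs_def by auto
    obtain i where i: "(\<sigma> ^^ i) y = x" "1 \<le> i" "i \<le> L"
      using orbit_split[OF \<sigma> q(3,4)] q(5) by metis
    have "inj (\<sigma> ^^ i)" using sym_group_inj[OF \<sigma>] by (rule inj_fn)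
    then have "y = inv (\<sigma> ^^ i) x" using i(1) by (metis inv_f_f)
    then show "q \<in> ?f ` ({1..n} \<times> {1..L})" using q i by (intro image_eqI[of _ _ "(x, i)"]) auto
  qed
  then have "card ?A \<le> card ({1..n} \<times> {1..L})" by (rule surj_card_le[rotated]) simp
  then show ?thesis by simp
qed

text \<open>
  A step joins a given short cycle to another cycle with probability of order \<open>1 / n\<close> at least,
  and creates a new one with probability of order \<open>L / n\<close> at most. So the number of short cycles
  decays exponentially on the time scale \<open>n\<close>, down to a bounded level.
\<close>

lemma step_avg_short_cycles:
  assumes \<sigma>: "\<sigma> \<in> sym_group n" and n: "2 \<le> n" "2 * L \<le> n"
  shows "step_avg n (\<lambda>\<tau>. short_cycles n L (\<sigma> \<circ> \<tau>)) \<le> (1 - 1 / (2 * real n)) * short_cycles n L \<sigma> + 4 * L / n"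
proof -
  let ?S = "real (short_cycles n L \<sigma>)"
  define new where "new = (\<lambda>(x, y). of_bool (y \<in> orbit \<sigma> x \<and> card (orbit (\<sigma> \<circ> transposition x y) x) \<le> L) :: real)"
  define lost where "lost = (\<lambda>(x, y). of_bool (y \<notin> orbit \<sigma> x \<and> card (orbit \<sigma> x) \<le> L) :: real)"
  have "(\<Sum>q\<in>pairs n. new q) = real (card {(x, y) \<in> pairs n. y \<in> orbit \<sigma> x \<and> card (orbit (\<sigma> \<circ> transposition x y) x) \<le> L})"
    unfolding new_def by (simp add: case_prod_unfold sum_of_bool_eq finite_pairs Int_def)
  also have "\<dots> \<le> real (n * L)" using card_short_splits[OF \<sigma>] of_nat_mono by blast
  finally have new: "(\<Sum>q\<in>pairs n. new q) \<le> real n * L" by simp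
  have lost: "?S * (real n - L) \<le> (\<Sum>q\<in>pairs n. lost q)"
  proof -
    let ?X = "{x \<in> {1..n}. card (orbit \<sigma> x) \<le> L}"
    have "{B \<in> cycle_sets n \<sigma>. card B \<le> L} \<subseteq> orbit \<sigma> ` ?X" unfolding cycle_sets_def by auto
    then have "short_cycles n L \<sigma> \<le> card ?X"
      unfolding short_cycles_def by (rule surj_card_le[rotated]) simp
    then have "?S * (real n - L) \<le> real (card ?X) * (real n - L)"
      using n by (intro mult_right_mono) auto
    also have "\<dots> = (\<Sum>x\<in>?X. real n - L)" by simp
    also have "\<dots> \<le> (\<Sum>x\<in>?X. \<Sum>y\<in>{1..n} - orbit \<sigma> x. 1)"
    proof (rule sum_mono)
      fix x assume x: "x \<in> ?X"
      then have sub: "orbit \<sigma> x \<subseteq> {1..n}" using orbit_subset_sym[OF \<sigma>] by blast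
      then have "card ({1..n} - orbit \<sigma> x) = n - card (orbit \<sigma> x)"
        by (simp add: card_Diff_subset finite_subset)
      moreover have "real n - L \<le> real (n - card (orbit \<sigma> x))"
        using x by (auto simp: of_nat_diff_if)
      ultimately show "real n - L \<le> (\<Sum>y\<in>{1..n} - orbit \<sigma> x. 1)" by simp
    qed
    also have "\<dots> = (\<Sum>(x, y)\<in>Sigma ?X (\<lambda>x. {1..n} - orbit \<sigma> x). 1)" by (rule sum.Sigma) auto
    also have "\<dots> = (\<Sum>q\<in>Sigma ?X (\<lambda>x. {1..n} - orbit \<sigma> x). lost q)"
      unfolding lost_def by (intro sum.cong) auto
    also have "\<dots> \<le> (\<Sum>q\<in>pairs n. lost q)"
      using self_in_orbit_sym[OF \<sigma>] unfolding pairs_def lost_def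
      by (intro sum_mono2 finite_pairs[unfolded pairs_def]) auto
    finally show ?thesis .
  qed
  have step: "real (short_cycles n L (\<sigma> \<circ> transposition x y)) \<le> ?S + new (x, y) + new (y, x) - lost (x, y)"
    if "(x, y) \<in> pairs n" for x y
  proof -
    have xy: "x \<in> {1..n}" "y \<in> {1..n}" "x \<noteq> y" using that unfolding pairs_def by auto
    show ?thesis
    proof (cases "y \<in> orbit \<sigma> x")
      case True
      then have "x \<in> orbit \<sigma> y" using \<sigma> orbit_swap self_in_orbit_sym by metis
      then have "new (x, y) = of_bool (card (orbit (\<sigma> \<circ> transposition x y) x) \<le> L)"
        "new (y, x) = of_bool (card (orbit (\<sigma> \<circ> transposition x y) y) \<le> L)" "lost (x, y) = 0"
        unfolding new_def lost_def using True by (auto simp: Transposition.transpose_commute)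
      then show ?thesis
        using short_cycles_split[OF \<sigma> xy True, of L, THEN of_nat_mono[where 'a = real]] by simp
    next
      case False
      then have "x \<notin> orbit \<sigma> y" using \<sigma> orbit_swap self_in_orbit_sym by metis
      then have "new (x, y) = 0" "new (y, x) = 0" "lost (x, y) = of_bool (card (orbit \<sigma> x) \<le> L)"
        unfolding new_def lost_def using False by auto
      then show ?thesis
        using short_cycles_merge[OF \<sigma> xy(1,2) False, of L, THEN of_nat_mono[where 'a = real]] by simp
    qed
  qed
  have "(\<Sum>(x, y)\<in>pairs n. real (short_cycles n L (\<sigma> \<circ> transposition x y)))
      \<le> (\<Sum>(x, y)\<in>pairs n. ?S + new (x, y) + new (y, x) - lost (x, y))"
    using step by (intro sum_mono) auto
  also have "\<dots> = card (pairs n) * ?S + (\<Sum>(x, y)\<in>pairs n. new (x, y))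
      + (\<Sum>(x, y)\<in>pairs n. new (y, x)) - (\<Sum>(x, y)\<in>pairs n. lost (x, y))"
    by (simp add: case_prod_unfold sum.distrib sum_subtractf)
  also have "(\<Sum>(x, y)\<in>pairs n. new (y, x)) = (\<Sum>(x, y)\<in>pairs n. new (x, y))"
    by (rule sum_pairs_swap)
  also have "(\<Sum>(x, y)\<in>pairs n. new (x, y)) = (\<Sum>q\<in>pairs n. new q)" by simp
  also have "(\<Sum>(x, y)\<in>pairs n. lost (x, y)) = (\<Sum>q\<in>pairs n. lost q)" by simp
  finally have "(\<Sum>(x, y)\<in>pairs n. real (short_cycles n L (\<sigma> \<circ> transposition x y)))
      \<le> real n * (real n - 1) * ?S + 2 * (real n * L) - ?S * (real n - L)"
    using new lost unfolding card_pairs by linarith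
  then have "step_avg n (\<lambda>\<tau>. short_cycles n L (\<sigma> \<circ> \<tau>))
      \<le> (real n * (real n - 1) * ?S + 2 * (real n * L) - ?S * (real n - L)) / (real n * (real n - 1))"
    unfolding step_avg_pairs using n by (intro divide_right_mono) auto
  also have "\<dots> = ?S + 2 * L / (real n - 1) - (real n - L) / (real n * (real n - 1)) * ?S"
  proof -
    have "real n - 1 \<noteq> 0" "real n \<noteq> 0" using n by auto
    then have "real n * (real n - 1) * ?S / (real n * (real n - 1)) = ?S"
      "2 * (real n * L) / (real n * (real n - 1)) = 2 * L / (real n - 1)"
      by simp_all
    moreover have "?S * (real n - L) / (real n * (real n - 1))
        = (real n - L) / (real n * (real n - 1)) * ?S"
      by (simp only: times_divide_eq_left mult.commute[of ?S])
    ultimately show ?thesis by (simp only: add_divide_distrib diff_divide_distrib)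
  qed
  also have "\<dots> \<le> ?S + 4 * L / n - 1 / (2 * real n) * ?S"
  proof -
    have "1 / (2 * real n) \<le> (real n - L) / (real n * (real n - 1))"
    proof -
      have "1 / (2 * real n) = (real n / 2) / (real n * real n)" using n by simp
      also have "\<dots> \<le> (real n - L) / (real n * (real n - 1))"
        using n by (intro frac_le mult_left_mono) auto
      finally show ?thesis .
    qed
    then have "1 / (2 * real n) * ?S \<le> (real n - L) / (real n * (real n - 1)) * ?S"
      by (intro mult_right_mono) auto
    moreover have "2 * L / (real n - 1) \<le> 4 * L / n"
    proof -
      have "1 / (real n - 1) \<le> 2 / n" using n by (simp add: field_simps)
      then have "(2 * real L) * (1 / (real n - 1)) \<le> (2 * real L) * (2 / n)"
        by (intro mult_left_mono) auto
      then show ?thesis by simp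
    qed
    ultimately show ?thesis by linarith
  qed
  finally show ?thesis by (simp add: algebra_simps)
qed

section \<open>A maximal inequality for the walk\<close>

abbreviation step_measure :: "nat \<Rightarrow> (real \<times> (nat \<Rightarrow> nat)) measure" where
  "step_measure n \<equiv> density lborel (exponential_density 1) \<Otimes>\<^sub>M uniform_count_measure (transpositions n)"

lemma prob_space_transpositions: "2 \<le> n \<Longrightarrow> prob_space (uniform_count_measure (transpositions n))"
  by (rule prob_space_uniform_count_measure[OF finite_transpositions transpositions_nonempty])

lemma prob_space_step: "2 \<le> n \<Longrightarrow> prob_space (step_measure n)"
  by (intro prob_space_pair prob_space_exponential_density prob_space_transpositions) auto

lemma sequence_space_step:
  assumes "2 \<le> n"
  shows "sequence_space (step_measure n)"
proof -
  interpret prob_space "step_measure n" by (rule prob_space_step[OF assms])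
  show ?thesis by unfold_locales
qed

lemma prob_space_walk: "2 \<le> n \<Longrightarrow> prob_space (walk_space n)"
  unfolding walk_space_def by (intro prob_space_PiM prob_space_step)

lemma measurable_step: "(\<lambda>\<omega>. \<omega> i) \<in> walk_space n \<rightarrow>\<^sub>M step_measure n"
  unfolding walk_space_def by measurable

lemma snd_in_transpositions:
  assumes "\<omega> \<in> space (walk_space n)"
  shows "snd (\<omega> i) \<in> transpositions n"
  using measurable_space[OF measurable_step assms, of i]
  by (auto simp: space_pair_measure space_uniform_count_measure)

lemma jump_chain_in_sym_group:
  assumes "\<omega> \<in> space (walk_space n)"
  shows "jump_chain \<omega> k \<in> sym_group n"
proof (induct k)
  case 0
  show ?case unfolding jump_chain.simps by (rule id_in_sym_group)
next
  case (Suc k)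
  then show ?case
    using snd_in_transpositions[OF assms, of k] transpositions_subset comp_in_sym_group
    unfolding jump_chain.simps by blast
qed

lemma measurable_jump_chain:
  "(\<lambda>\<omega>. jump_chain \<omega> k) \<in> walk_space n \<rightarrow>\<^sub>M count_space (sym_group n)"
proof (induct k)
  case 0
  show ?case unfolding jump_chain.simps by (rule measurable_const) (simp only: space_count_space id_in_sym_group)
next
  case (Suc k)
  have "(\<lambda>\<omega>. \<rho> \<circ> snd (\<omega> k)) \<in> walk_space n \<rightarrow>\<^sub>M count_space (sym_group n)" if \<rho>: "\<rho> \<in> sym_group n" for \<rho>
  proof -
    have 1: "(\<lambda>\<omega>. snd (\<omega> k)) \<in> walk_space n \<rightarrow>\<^sub>M uniform_count_measure (transpositions n)"
      by (rule measurable_compose[OF measurable_step measurable_snd])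
    have "(\<lambda>\<tau>. \<rho> \<circ> \<tau>) \<in> count_space (transpositions n) \<rightarrow>\<^sub>M count_space (sym_group n)"
      using comp_in_sym_group[OF \<rho> subsetD[OF transpositions_subset]] by simp
    then have 2: "(\<lambda>\<tau>. \<rho> \<circ> \<tau>) \<in> uniform_count_measure (transpositions n) \<rightarrow>\<^sub>M count_space (sym_group n)"
      by (simp only: measurable_cong_sets[OF sets_uniform_count_measure_count_space refl])
    show ?thesis by (rule measurable_compose[OF 1 2])
  qed
  then show ?case
    unfolding jump_chain.simps
    by (rule measurable_compose_countable'[OF _ Suc]) (use countable_finite finite_sym_group in auto)
qed

lemma jump_chain_case_nat:
  "jump_chain (case_nat s \<omega>) (Suc k) = snd s \<circ> jump_chain \<omega> k"
proof (induct k)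
  case 0
  show ?case by (simp only: jump_chain.simps old.nat.case id_comp comp_id)
next
  case (Suc k)
  show ?case
    unfolding jump_chain.simps(2)[of _ "Suc k"] Suc by (simp only: jump_chain.simps old.nat.case comp_assoc)
qed

lemma nn_integral_step:
  assumes n: "2 \<le> n" and g: "\<And>\<tau>. \<tau> \<in> transpositions n \<Longrightarrow> 0 \<le> g \<tau>"
  shows "(\<integral>\<^sup>+ s. ennreal (g (snd s)) \<partial>step_measure n) = ennreal (step_avg n g)"
proof -
  let ?E = "density lborel (exponential_density 1)" and ?T = "uniform_count_measure (transpositions n)"
  interpret E: prob_space ?E by (rule prob_space_exponential_density) simp
  interpret T: prob_space ?T by (rule prob_space_transpositions[OF n])
  have "(\<lambda>\<tau>. ennreal (g \<tau>)) \<in> borel_measurable ?T"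
    by (simp add: measurable_cong_sets[OF sets_uniform_count_measure_count_space refl])
  then have "(\<lambda>s. ennreal (g (snd s))) \<in> borel_measurable (?E \<Otimes>\<^sub>M ?T)"
    by (rule measurable_compose[OF measurable_snd])
  then have "(\<integral>\<^sup>+ s. ennreal (g (snd s)) \<partial>step_measure n) = (\<integral>\<^sup>+ x. \<integral>\<^sup>+ \<tau>. ennreal (g \<tau>) \<partial>?T \<partial>?E)"
    by (subst T.nn_integral_fst[symmetric]) auto
  also have "\<dots> = (\<integral>\<^sup>+ \<tau>. ennreal (g \<tau>) \<partial>?T)" 
    by (simp only: nn_integral_const E.emeasure_space_1 mult_1_right)
  also have "\<dots> = (\<Sum>\<tau>\<in>transpositions n. ennreal (1 / card (transpositions n)) * ennreal (g \<tau>))"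
    unfolding uniform_count_measure_def by (rule nn_integral_point_measure_finite[OF finite_transpositions])
  also have "\<dots> = (\<Sum>\<tau>\<in>transpositions n. ennreal (g \<tau> / card (transpositions n)))"
    using g by (intro sum.cong refl) (simp flip: ennreal_mult)
  also have "\<dots> = ennreal (step_avg n g)"
    unfolding step_avg_def sum_divide_distrib using g by (intro sum_ennreal) simp
  finally show ?thesis .
qed

lemma sets_exceeds:
  "{\<omega> \<in> space (walk_space n). \<exists>i\<le>k. \<theta> \<le> G i (jump_chain \<omega> i)} \<in> sets (walk_space n)"
proof -
  have "{\<omega> \<in> space (walk_space n). \<exists>i\<le>k. \<theta> \<le> G i (jump_chain \<omega> i)}
      = (\<Union>i\<in>{..k}. (\<lambda>\<omega>. jump_chain \<omega> i) -` {\<sigma> \<in> sym_group n. \<theta> \<le> G i \<sigma>} \<inter> space (walk_space n))"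
    using jump_chain_in_sym_group by auto
  also have "\<dots> \<in> sets (walk_space n)"
    by (intro sets.finite_UN measurable_sets[OF measurable_jump_chain]) auto
  finally show ?thesis .
qed

text \<open>
  Ville's inequality for a nonnegative supermartingale that is a function of time and position.
  It controls all times at once, hence also the position at a random time. The induction
  conditions on the first step.
\<close>

lemma emeasure_exceeds_le:
  assumes n: "2 \<le> n" and \<theta>: "0 < \<theta>"
    and pos: "\<And>j \<sigma>. j \<le> K \<Longrightarrow> \<sigma> \<in> sym_group n \<Longrightarrow> 0 \<le> G j \<sigma>"
    and super: "\<And>j \<sigma>. j < K \<Longrightarrow> \<sigma> \<in> sym_group n \<Longrightarrow> step_avg n (\<lambda>\<tau>. G (Suc j) (\<sigma> \<circ> \<tau>)) \<le> G j \<sigma>"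
  shows "j + k \<le> K \<Longrightarrow> \<sigma> \<in> sym_group n \<Longrightarrow>
    emeasure (walk_space n) {\<omega> \<in> space (walk_space n). \<exists>i\<le>k. \<theta> \<le> G (j + i) (\<sigma> \<circ> jump_chain \<omega> i)}
      \<le> ennreal (G j \<sigma> / \<theta>)"
proof (induct k arbitrary: j \<sigma>)
  case (0 j \<sigma>)
  interpret prob_space "walk_space n" by (rule prob_space_walk[OF n])
  show ?case
  proof (cases "\<theta> \<le> G j \<sigma>")
    case True
    then have "1 \<le> ennreal (G j \<sigma> / \<theta>)" using \<theta> by simp
    then show ?thesis using emeasure_le_1 order_trans by blast
  next
    case False
    have "\<sigma> \<circ> jump_chain \<omega> 0 = \<sigma>" for \<omega> :: "nat \<Rightarrow> real \<times> (nat \<Rightarrow> nat)"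
      by (simp only: jump_chain.simps comp_id)
    then have empty: "{\<omega> \<in> space (walk_space n). \<exists>i\<le>0. \<theta> \<le> G (j + i) (\<sigma> \<circ> jump_chain \<omega> i)} = {}"
      using False by (simp only: le_zero_eq ex_simps simp_thms add_0_right Collect_empty_eq)
    show ?thesis unfolding empty by simp
  qed
next
  case (Suc k j \<sigma>)
  let ?W = "walk_space n" and ?M = "step_measure n"
  interpret S: sequence_space ?M by (rule sequence_space_step[OF n])
  interpret W: prob_space ?W by (rule prob_space_walk[OF n])
  have W: "?W = S.S" unfolding walk_space_def ..
  define A where "A = (\<lambda>\<rho>. {\<omega> \<in> space ?W. \<exists>i\<le>k. \<theta> \<le> G (Suc j + i) (\<rho> \<circ> jump_chain \<omega> i)})"
  let ?E = "{\<omega> \<in> space ?W. \<exists>i\<le>Suc k. \<theta> \<le> G (j + i) (\<sigma> \<circ> jump_chain \<omega> i)}"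
  have E: "?E \<in> sets ?W" by (rule sets_exceeds)
  show ?case
  proof (cases "\<theta> \<le> G j \<sigma>")
    case True
    then have "1 \<le> ennreal (G j \<sigma> / \<theta>)" using \<theta> by simp
    then show ?thesis using W.emeasure_le_1 order_trans by blast
  next
    case False
    have range: "\<sigma> \<circ> \<tau> \<in> sym_group n" if "\<tau> \<in> transpositions n" for \<tau>
      using that comp_in_sym_group Suc.prems(2) transpositions_subset by blast
    have pre: "(case_nat s \<omega> \<in> ?E) = (\<omega> \<in> A (\<sigma> \<circ> snd s))" if "s \<in> space ?M" "\<omega> \<in> space ?W" for s \<omega>
    proof -
      have "case_nat s \<omega> \<in> space ?W"
        using that unfolding walk_space_def by (auto simp: space_PiM PiE_iff split: nat.split)
      moreover have "(\<exists>i\<le>Suc k. P i) \<longleftrightarrow> P 0 \<or> (\<exists>i\<le>k. P (Suc i))" for P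
        by (metis Suc_le_mono le0 old.nat.exhaust)
      ultimately show ?thesis
        using False that(2) unfolding A_def mem_Collect_eq
        by (simp only: jump_chain_case_nat) (simp add: comp_assoc)
    qed
    have meas: "(\<lambda>(s, \<omega>). case_nat s \<omega>) \<in> ?M \<Otimes>\<^sub>M ?W \<rightarrow>\<^sub>M ?W"
      unfolding walk_space_def by measurable
    have iter: "distr (?M \<Otimes>\<^sub>M ?W) ?W (\<lambda>(s, \<omega>). case_nat s \<omega>) = ?W"
      unfolding W by (rule S.PiM_iter)
    let ?f = "indicator ?E :: _ \<Rightarrow> ennreal"
    have ind: "?f \<in> borel_measurable ?W" using E by (rule borel_measurable_indicator)
    note iE = measurable_compose[OF meas ind]
    have "emeasure ?W ?E = (\<integral>\<^sup>+ \<omega>. ?f \<omega> \<partial>?W)"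
      by (rule nn_integral_indicator[OF E, symmetric])
    also have "\<dots> = (\<integral>\<^sup>+ \<omega>. ?f \<omega> \<partial>distr (?M \<Otimes>\<^sub>M ?W) ?W (\<lambda>(s, \<omega>). case_nat s \<omega>))"
      by (simp only: iter)
    also have "\<dots> = (\<integral>\<^sup>+ q. ?f (case q of (s, \<omega>) \<Rightarrow> case_nat s \<omega>) \<partial>(?M \<Otimes>\<^sub>M ?W))"
      by (rule nn_integral_distr[OF meas]) (simp only: measurable_distr_eq1 ind)
    also have "\<dots> = (\<integral>\<^sup>+ s. \<integral>\<^sup>+ \<omega>. ?f (case_nat s \<omega>) \<partial>?W \<partial>?M)"
      using W.nn_integral_fst[OF iE] by (simp only: prod.case)
    also have "\<dots> = (\<integral>\<^sup>+ s. emeasure ?W (A (\<sigma> \<circ> snd s)) \<partial>?M)"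
    proof (rule nn_integral_cong)
      fix s assume s: "s \<in> space ?M"
      have "(\<integral>\<^sup>+ \<omega>. ?f (case_nat s \<omega>) \<partial>?W) = (\<integral>\<^sup>+ \<omega>. indicator (A (\<sigma> \<circ> snd s)) \<omega> \<partial>?W)"
        using pre[OF s] by (intro nn_integral_cong) (simp only: indicator_def)
      also have "\<dots> = emeasure ?W (A (\<sigma> \<circ> snd s))"
        unfolding A_def by (rule nn_integral_indicator[OF sets_exceeds])
      finally show "(\<integral>\<^sup>+ \<omega>. ?f (case_nat s \<omega>) \<partial>?W) = emeasure ?W (A (\<sigma> \<circ> snd s))" .
    qed
    also have "\<dots> \<le> (\<integral>\<^sup>+ s. ennreal (G (Suc j) (\<sigma> \<circ> snd s) / \<theta>) \<partial>?M)"
    proof (rule nn_integral_mono)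
      fix s assume "s \<in> space ?M"
      then have "snd s \<in> transpositions n"
        by (auto simp: space_pair_measure space_uniform_count_measure)
      then show "emeasure ?W (A (\<sigma> \<circ> snd s)) \<le> ennreal (G (Suc j) (\<sigma> \<circ> snd s) / \<theta>)"
        unfolding A_def using Suc.prems by (intro Suc.hyps range) auto
    qed
    also have "\<dots> = ennreal (step_avg n (\<lambda>\<tau>. G (Suc j) (\<sigma> \<circ> \<tau>) / \<theta>))"
      using Suc.prems \<theta> by (intro nn_integral_step[OF n] divide_nonneg_pos pos range) auto
    also have "\<dots> \<le> ennreal (G j \<sigma> / \<theta>)"
    proof (rule ennreal_leI)
      have "step_avg n (\<lambda>\<tau>. G (Suc j) (\<sigma> \<circ> \<tau>) / \<theta>) = step_avg n (\<lambda>\<tau>. G (Suc j) (\<sigma> \<circ> \<tau>)) / \<theta>"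
        unfolding step_avg_def by (simp add: sum_divide_distrib mult.commute)
      also have "\<dots> \<le> G j \<sigma> / \<theta>"
        using super[of j \<sigma>] Suc.prems \<theta> by (intro divide_right_mono) auto
      finally show "step_avg n (\<lambda>\<tau>. G (Suc j) (\<sigma> \<circ> \<tau>) / \<theta>) \<le> G j \<sigma> / \<theta>" .
    qed
    finally show ?thesis .
  qed
qed

lemma prob_exceeds_le:
  assumes "2 \<le> n" and "0 < \<theta>"
    and "\<And>j \<sigma>. j \<le> K \<Longrightarrow> \<sigma> \<in> sym_group n \<Longrightarrow> 0 \<le> G j \<sigma>"
    and "\<And>j \<sigma>. j < K \<Longrightarrow> \<sigma> \<in> sym_group n \<Longrightarrow> step_avg n (\<lambda>\<tau>. G (Suc j) (\<sigma> \<circ> \<tau>)) \<le> G j \<sigma>"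
  shows "measure (walk_space n) {\<omega> \<in> space (walk_space n). \<exists>i\<le>K. \<theta> \<le> G i (jump_chain \<omega> i)}
    \<le> G 0 id / \<theta>"
proof -
  interpret prob_space "walk_space n" by (rule prob_space_walk[OF assms(1)])
  let ?E = "{\<omega> \<in> space (walk_space n). \<exists>i\<le>K. \<theta> \<le> G i (jump_chain \<omega> i)}"
  have "emeasure (walk_space n) ?E \<le> ennreal (G 0 id / \<theta>)"
    using emeasure_exceeds_le[where n = n and \<theta> = \<theta> and K = K and G = G and j = 0 and k = K and \<sigma> = id,
        OF assms]
    by (simp only: add_0 id_comp id_in_sym_group order_refl)
  moreover have "0 \<le> G 0 id / \<theta>"
    using assms(2) assms(3)[OF le0 id_in_sym_group] by (intro divide_nonneg_pos)
  ultimately show ?thesis unfolding emeasure_eq_measure by (simp only: ennreal_le_iff)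
qed

section \<open>The hitting law\<close>

lemma AE_holding_times_pos:
  assumes n: "2 \<le> n"
  shows "AE \<omega> in walk_space n. \<forall>i. 0 < fst (\<omega> i)"
proof -
  let ?E = "density lborel (exponential_density 1)" and ?T = "uniform_count_measure (transpositions n)"
  interpret T: prob_space ?T by (rule prob_space_transpositions[OF n])
  have "AE x in ?E. 0 < x"
    using AE_lborel_singleton[of 0]
    by (subst AE_density) (auto simp: exponential_density_def elim!: eventually_mono split: if_splits)
  then have "AE x in distr (step_measure n) ?E fst. 0 < x"
    by (simp only: T.distr_pair_fst)
  then have "AE s in step_measure n. 0 < fst s"
    by (rule AE_distrD[OF measurable_fst])
  then have "AE \<omega> in walk_space n. 0 < fst (\<omega> i)" for i
    unfolding walk_space_def by (intro AE_PiM_component prob_space_step n) auto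
  then show ?thesis by (simp add: AE_all_countable)
qed

lemma cayley_dist_step:
  assumes \<omega>: "\<omega> \<in> space (walk_space n)"
  shows "cayley_dist n (jump_chain \<omega> (Suc k)) \<le> Suc (cayley_dist n (jump_chain \<omega> k))"
proof -
  have "cayley_dist n (jump_chain \<omega> (Suc k)) = n - num_cycles n (jump_chain \<omega> k \<circ> snd (\<omega> k))"
    using cayley_dist_eq[OF jump_chain_in_sym_group[OF \<omega>, of "Suc k"]] by (simp only: jump_chain.simps)
  moreover have "cayley_dist n (jump_chain \<omega> k) = n - num_cycles n (jump_chain \<omega> k)"
    by (rule cayley_dist_eq[OF jump_chain_in_sym_group[OF \<omega>]])
  moreover have "num_cycles n (jump_chain \<omega> k) \<le> Suc (num_cycles n (jump_chain \<omega> k \<circ> snd (\<omega> k)))"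
    by (rule num_cycles_step[OF jump_chain_in_sym_group[OF \<omega>] snd_in_transpositions[OF \<omega>]])
  ultimately show ?thesis by linarith
qed

text \<open>
  The distance grows by at most one in each step, so the walk cannot jump over the sphere and needs
  at least \<open>m\<close> steps to reach it.
\<close>

lemma first_passage:
  assumes \<omega>: "\<omega> \<in> space (walk_space n)" and m: "m \<le> cayley_dist n (jump_chain \<omega> K)"
  obtains k where "k \<le> K" "m \<le> k" "cayley_dist n (jump_chain \<omega> k) = m"
    "\<And>i. i < k \<Longrightarrow> cayley_dist n (jump_chain \<omega> i) < m"
proof -
  let ?d = "\<lambda>k. cayley_dist n (jump_chain \<omega> k)"
  have d0: "?d 0 = 0"
    unfolding jump_chain.simps cayley_dist_eq[OF id_in_sym_group] num_cycles_id by simp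
  have le: "?d k \<le> k" for k
  proof (induct k)
    case 0
    show ?case using d0 by linarith
  next
    case (Suc k)
    then show ?case using cayley_dist_step[OF \<omega>, of k] by linarith
  qed
  define k where "k = (LEAST k. m \<le> ?d k)"
  have k: "m \<le> ?d k" "k \<le> K"
    unfolding k_def using m by (rule LeastI, rule Least_le)
  have first: "?d i < m" if "i < k" for i
    using not_less_Least that unfolding k_def by (meson not_le)
  have "?d k = m"
  proof (cases k)
    case 0
    then show ?thesis using k(1) d0 by simp
  next
    case (Suc i)
    then show ?thesis using first[of i] cayley_dist_step[OF \<omega>, of i] k(1) by simp
  qed
  then show thesis using that[of k] k le[of k] first by simp
qed

text \<open>
  With positive holding times the jump times increase, and the walk is constant from each jump time
  until just before the next one; so the infimum is attained at the jump that enters the sphere.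
\<close>

lemma walk_hitting_time:
  assumes pos: "\<And>i. 0 < fst (\<omega> i)"
    and hit: "int (cayley_dist n (jump_chain \<omega> k)) = \<lfloor>a * real n\<rfloor>"
    and first: "\<And>i. i < k \<Longrightarrow> int (cayley_dist n (jump_chain \<omega> i)) \<noteq> \<lfloor>a * real n\<rfloor>"
    and k: "0 < k"
  shows "walk \<omega> (hitting_time n a \<omega>) = jump_chain \<omega> k"
proof -
  let ?s = "\<lambda>k. jump_time k \<omega>"
  have less: "?s i < ?s (Suc i)" for i using pos by (simp add: jump_time_def)
  have mono: "?s i \<le> ?s j" if "i \<le> j" for i j
    using lift_Suc_mono_le[of ?s, OF less_imp_le[OF less] that] .
  have num: "num_jumps \<omega> t = k" if "?s k \<le> t" "t < ?s (Suc k)" for t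
    unfolding num_jumps_def
  proof (rule Least_equality)
    show "t < ?s (Suc k)" by (rule that)
    show "k \<le> i" if "t < ?s (Suc i)" for i
      using mono[of "Suc i" k] that \<open>?s k \<le> t\<close> by (meson leD le_less_trans not_less_eq_eq)
  qed
  have early: "num_jumps \<omega> t < k" if "t < ?s k" for t
  proof -
    have "num_jumps \<omega> t \<le> k - 1"
      unfolding num_jumps_def using that k by (intro Least_le) simp
    then show ?thesis using k by simp
  qed
  have s_pos: "0 < ?s k" using less[of 0] mono[of 1 k] k by (simp add: jump_time_def)
  let ?H = "{t. t > 0 \<and> int (cayley_dist n (walk \<omega> t)) = \<lfloor>a * real n\<rfloor>}"
  have "?s k \<in> ?H" using num[of "?s k"] less s_pos hit unfolding walk_def by simp
  moreover have "?s k \<le> t" if "t \<in> ?H" for t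
    using that early[of t] first unfolding walk_def by force
  ultimately have "hitting_time n a \<omega> = ?s k"
    unfolding hitting_time_def by (intro cInf_eq_minimum)
  then show ?thesis unfolding walk_def using num less by simp
qed

text \<open>
  If the pushforward formula does not define a measure, \<open>distr\<close> takes the value zero everywhere;
  and a preimage that is not measurable has measure zero by convention. So this inequality holds
  for every map.
\<close>

lemma emeasure_distr_le:
  "emeasure (distr M N f) A \<le> emeasure M (f -` A \<inter> space M)"
  unfolding distr_def emeasure_measure_of_conv by simp

lemma measure_hitting_law_le:
  assumes n: "2 \<le> n" and B: "B \<in> sets (walk_space n)"
    and sub: "\<And>\<omega>. \<omega> \<in> space (walk_space n) \<Longrightarrow> (\<And>i. 0 < fst (\<omega> i)) \<Longrightarrow>
      walk \<omega> (hitting_time n a \<omega>) \<in> A \<Longrightarrow> \<omega> \<in> B"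
  shows "measure (hitting_law n a) A \<le> measure (walk_space n) B"
proof -
  interpret prob_space "walk_space n" by (rule prob_space_walk[OF n])
  let ?f = "\<lambda>\<omega>. walk \<omega> (hitting_time n a \<omega>)"
  have "emeasure (hitting_law n a) A \<le> emeasure (walk_space n) (?f -` A \<inter> space (walk_space n))"
    unfolding hitting_law_def by (rule emeasure_distr_le)
  also have "\<dots> \<le> emeasure (walk_space n) B"
  proof (intro emeasure_mono_AE B)
    show "AE \<omega> in walk_space n. \<omega> \<in> ?f -` A \<inter> space (walk_space n) \<longrightarrow> \<omega> \<in> B"
      using AE_holding_times_pos[OF n] by eventually_elim (use sub in blast)
  qed
  finally show ?thesis
    unfolding measure_def by (rule enn2real_mono) (simp add: emeasure_finite flip: less_top)
qed

section \<open>Deviations up to a given time\<close>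

lemma prob_curve_error_le:
  fixes r :: real
  assumes n: "5 \<le> n" and r: "0 < r"
  shows "measure (walk_space n) {\<omega> \<in> space (walk_space n). \<exists>i\<le>K. r \<le> curve_error n i (jump_chain \<omega> i)}
    \<le> 1400 * real K * (1 + 8 / real n) ^ K / r"
proof -
  let ?q = "1 + 8 / real n"
  (* Undoing the growth factor and storing the drift that is still to come gives a supermartingale. *)
  define G where "G = (\<lambda>j \<sigma>. curve_error n j \<sigma> / ?q ^ j + 1400 * (real K - real j))"
  have n2: "2 \<le> n" using n by simp
  have q: "1 \<le> ?q" "0 < ?q" by (simp_all add: add_pos_nonneg)
  interpret prob_space "walk_space n" by (rule prob_space_walk[OF n2])
  have ce: "0 \<le> curve_error n j \<sigma>" for j \<sigma> unfolding curve_error_def by simp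
  have super: "step_avg n (\<lambda>\<tau>. G (Suc j) (\<sigma> \<circ> \<tau>)) \<le> G j \<sigma>" if "j < K" "\<sigma> \<in> sym_group n" for j \<sigma>
  proof -
    have "step_avg n (\<lambda>\<tau>. G (Suc j) (\<sigma> \<circ> \<tau>))
        = 1 / ?q ^ Suc j * step_avg n (\<lambda>\<tau>. curve_error n (Suc j) (\<sigma> \<circ> \<tau>)) + 1400 * (real K - real (Suc j))"
      unfolding G_def step_avg_add step_avg_const[OF n2] step_avg_mult[symmetric] by simp
    also have "\<dots> \<le> 1 / ?q ^ Suc j * (?q * curve_error n j \<sigma> + 1400) + 1400 * (real K - real (Suc j))"
      using step_avg_curve_error[OF n that(2)] q by (intro add_right_mono mult_left_mono) auto
    also have "\<dots> = curve_error n j \<sigma> / ?q ^ j + 1400 * (1 / ?q ^ Suc j) + 1400 * (real K - real (Suc j))"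
    proof -
      have "?q \<noteq> 0" using q by linarith
      then have "1 / ?q ^ Suc j * (?q * curve_error n j \<sigma>) = curve_error n j \<sigma> / ?q ^ j" by simp
      then show ?thesis by (simp only: distrib_left)
    qed
    also have "1 / ?q ^ Suc j \<le> 1" using one_le_power[OF q(1), of "Suc j"]
      by (intro divide_le_eq_1_pos[THEN iffD2]) linarith+
    finally show ?thesis unfolding G_def by simp
  qed
  have sub: "r / ?q ^ K \<le> G i \<sigma>" if "r \<le> curve_error n i \<sigma>" "i \<le> K" for i \<sigma>
  proof -
    have "r / ?q ^ K \<le> curve_error n i \<sigma> / ?q ^ i"
      using that r q ce by (intro frac_le power_increasing zero_less_power) auto
    then show ?thesis using that(2) unfolding G_def by simp
  qed
  have "measure (walk_space n) {\<omega> \<in> space (walk_space n). \<exists>i\<le>K. r \<le> curve_error n i (jump_chain \<omega> i)}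
      \<le> measure (walk_space n) {\<omega> \<in> space (walk_space n). \<exists>i\<le>K. r / ?q ^ K \<le> G i (jump_chain \<omega> i)}"
    using sub by (intro finite_measure_mono sets_exceeds) blast
  also have "\<dots> \<le> G 0 id / (r / ?q ^ K)"
  proof (rule prob_exceeds_le[OF n2])
    show "0 < r / ?q ^ K" using r q by (intro divide_pos_pos zero_less_power) auto
    show "0 \<le> G j \<sigma>" if "j \<le> K" for j \<sigma>
      using that ce q unfolding G_def by (intro add_nonneg_nonneg divide_nonneg_nonneg) auto
  qed (rule super)
  also have "G 0 id = 1400 * real K"
  proof -
    have "fixed_pts n id = n" "two_pts n id = 0" unfolding fixed_pts_def two_pts_def by simp_all
    then have "curve_error n 0 id = 0"
      unfolding curve_error_def fixed_curve_def two_curve_def by (simp only:) simp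
    then show ?thesis unfolding G_def by (simp only:) simp
  qed
  finally show ?thesis by (simp add: mult.commute)
qed

lemma prob_short_cycles_le:
  fixes r :: real
  assumes n: "2 \<le> n" "2 * L \<le> n" and r: "0 < r"
  shows "measure (walk_space n) {\<omega> \<in> space (walk_space n). r \<le> short_cycles n L (jump_chain \<omega> K)}
    \<le> ((1 - 1 / (2 * real n)) ^ K * n + 4 * real L / n * K) / r"
proof -
  let ?q = "1 - 1 / (2 * real n)"
  define c where "c = 4 * real L / n"
  (* At time K this is the number of short cycles itself. *)
  define G where "G = (\<lambda>j \<sigma>. ?q ^ (K - j) * short_cycles n L \<sigma> + c * (real K - real j))"
  have q: "0 \<le> ?q" "?q \<le> 1" using n by (auto simp: field_simps)
  interpret prob_space "walk_space n" by (rule prob_space_walk[OF n(1)])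
  have super: "step_avg n (\<lambda>\<tau>. G (Suc j) (\<sigma> \<circ> \<tau>)) \<le> G j \<sigma>" if "j < K" "\<sigma> \<in> sym_group n" for j \<sigma>
  proof -
    have "step_avg n (\<lambda>\<tau>. G (Suc j) (\<sigma> \<circ> \<tau>))
        = ?q ^ (K - Suc j) * step_avg n (\<lambda>\<tau>. short_cycles n L (\<sigma> \<circ> \<tau>)) + c * (real K - real (Suc j))"
      unfolding G_def step_avg_add step_avg_const[OF n(1)] step_avg_mult ..
    also have "\<dots> \<le> ?q ^ (K - Suc j) * (?q * short_cycles n L \<sigma> + c) + c * (real K - real (Suc j))"
      using step_avg_short_cycles[OF that(2) n, folded c_def] q by (intro add_right_mono mult_left_mono) auto
    also have "\<dots> = ?q ^ (K - j) * short_cycles n L \<sigma> + ?q ^ (K - Suc j) * c + c * (real K - real (Suc j))"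
    proof -
      have "?q ^ (K - j) = ?q ^ (K - Suc j) * ?q"
        using that(1) by (metis Suc_diff_Suc power_Suc2)
      then show ?thesis by (simp only: distrib_left mult.assoc)
    qed
    also have "?q ^ (K - Suc j) * c \<le> 1 * c"
      using q by (intro mult_right_mono power_le_one) (auto simp: c_def)
    also have "?q ^ (K - j) * short_cycles n L \<sigma> + 1 * c + c * (real K - real (Suc j)) = G j \<sigma>"
      unfolding G_def by (simp add: algebra_simps)
    finally show ?thesis by simp
  qed
  have "measure (walk_space n) {\<omega> \<in> space (walk_space n). r \<le> short_cycles n L (jump_chain \<omega> K)}
      \<le> measure (walk_space n) {\<omega> \<in> space (walk_space n). \<exists>i\<le>K. r \<le> G i (jump_chain \<omega> i)}"
  proof (intro finite_measure_mono sets_exceeds subsetI)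
    fix \<omega> assume "\<omega> \<in> {\<omega> \<in> space (walk_space n). r \<le> short_cycles n L (jump_chain \<omega> K)}"
    moreover have "G K (jump_chain \<omega> K) = short_cycles n L (jump_chain \<omega> K)"
      unfolding G_def by simp
    ultimately show "\<omega> \<in> {\<omega> \<in> space (walk_space n). \<exists>i\<le>K. r \<le> G i (jump_chain \<omega> i)}" by auto
  qed
  also have "\<dots> \<le> G 0 id / r"
  proof (rule prob_exceeds_le[OF n(1) r])
    show "0 \<le> G j \<sigma>" if "j \<le> K" for j \<sigma>
      using that q unfolding G_def by (intro add_nonneg_nonneg mult_nonneg_nonneg) (auto simp: c_def)
  qed (rule super)
  also have "G 0 id \<le> ?q ^ K * n + c * K"
    unfolding G_def using q short_cycles_le[of n L id] by (simp add: mult_left_mono)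
  finally show ?thesis unfolding c_def using r by (simp add: divide_right_mono)
qed

section \<open>The two curves are apart\<close>

text \<open>
  In the limit, with \<open>s = 2 j / n\<close>, the gap between \<open>f (1 - f)\<close> and \<open>d\<close> is
  \<open>e\<^sup>-\<^sup>s (1 - e\<^sup>-\<^sup>s) - s e\<^sup>-\<^sup>2\<^sup>s = e\<^sup>-\<^sup>2\<^sup>s (e\<^sup>s - 1 - s)\<close>, and \<open>e\<^sup>s - 1 - s\<close> is at least \<open>s\<^sup>2 / 2\<close>. Half of this
  is given away to the error of the powers of \<open>1 - 2 / n\<close>.
\<close>

lemma curve_gap:
  fixes a :: real and C :: nat
  assumes a: "0 < a" and n: "4 \<le> n" "128 * real C / a\<^sup>2 \<le> n" and j: "a / 2 * n \<le> j" "j \<le> C * n"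
  shows "exp (- 8 * real C) * a\<^sup>2 / 4 * (real n)\<^sup>2
    \<le> fixed_curve n j * (n - fixed_curve n j) - n * two_curve n j"
proof -
  define \<rho> where "\<rho> = 1 - 2 / real n"
  define s where "s = 2 * real j / n"
  define q where "q = \<rho> ^ j"
  have N: "4 \<le> real n" using n by simp
  have \<rho>: "1 / 2 \<le> \<rho>" "\<rho> < 1" unfolding \<rho>_def using N by (auto simp: field_simps)
  have s: "a \<le> s" "s \<le> 2 * C"
  proof -
    show "a \<le> s" unfolding s_def using j(1) N by (simp add: field_simps)
    have "real j \<le> real C * n" using j(2) by (simp flip: of_nat_mult)
    then show "s \<le> 2 * C" unfolding s_def using N by (simp add: field_simps)
  qed
  have "0 < real j" using j(1) a N by (smt (verit) divide_pos_pos mult_pos_pos)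
  then have j1: "1 \<le> j" by simp
  have q_pos: "0 < q" unfolding q_def using \<rho> by simp
  have "\<rho> \<le> exp (- (2 / n))" unfolding \<rho>_def using exp_ge_add_one_self[of "- (2 / n)"] by simp
  then have "q \<le> exp (- (2 / n)) ^ j" unfolding q_def using \<rho> by (intro power_mono) auto
  also have "\<dots> = exp (- s)" unfolding s_def exp_of_nat_mult[symmetric] by simp
  finally have "exp s * q \<le> 1" by (simp add: exp_minus field_simps)
  have "exp (- 4 * real C) \<le> q"
  proof -
    have "exp (- (4 / n)) \<le> \<rho>"
    proof -
      have "1 \<le> \<rho> * (1 + 4 / n)" unfolding \<rho>_def using N by (simp add: field_simps)
      also have "\<dots> \<le> \<rho> * exp (4 / n)" using exp_ge_add_one_self[of "4 / n"] \<rho> by (intro mult_left_mono) auto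
      finally show ?thesis by (simp add: exp_minus field_simps)
    qed
    then have "exp (- (4 / n)) ^ j \<le> q" unfolding q_def by (intro power_mono) auto
    moreover have "exp (- (4 / n)) ^ j = exp (- 2 * s)" unfolding s_def exp_of_nat_mult[symmetric] by simp
    moreover have "exp (- 4 * real C) \<le> exp (- 2 * s)" using s by simp
    ultimately show ?thesis by linarith
  qed
  then have "(exp (- 4 * real C))\<^sup>2 \<le> q\<^sup>2" by (intro power_mono) auto
  moreover have "(exp (- 4 * real C))\<^sup>2 = exp (- 8 * real C)" by (simp flip: exp_of_nat_mult)
  ultimately have q2: "exp (- 8 * real C) \<le> q\<^sup>2" by simp
  define p where "p = \<rho> ^ (2 * j - 2)"
  have "2 * j = 2 + (2 * j - 2)" using j1 by simp
  then have "\<rho> ^ (2 * j) = \<rho>\<^sup>2 * p" unfolding p_def by (metis power_add)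
  then have p: "\<rho>\<^sup>2 * p = q\<^sup>2" unfolding q_def by (simp add: power_mult[symmetric] mult.commute)
  have p_le: "p \<le> q\<^sup>2 * (1 + 16 / n)"
  proof -
    have "1 \<le> \<rho>\<^sup>2 * (1 + 16 / n)"
    proof -
      have "1 - 4 / n \<le> \<rho>\<^sup>2" unfolding \<rho>_def using N by (simp add: power2_eq_square field_simps)
      moreover have "(1 / 2)\<^sup>2 \<le> \<rho>\<^sup>2" using \<rho> by (intro power_mono) auto
      then have "1 / 4 * (16 / n) \<le> \<rho>\<^sup>2 * (16 / n)"
        by (intro mult_right_mono) (auto simp: power2_eq_square)
      ultimately show ?thesis by (simp add: algebra_simps)
    qed
    have "p * 1 \<le> p * (\<rho>\<^sup>2 * (1 + 16 / n))"
      unfolding p_def using \<rho> \<open>1 \<le> \<rho>\<^sup>2 * (1 + 16 / n)\<close> by (intro mult_left_mono) auto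
    also have "\<dots> = (\<rho>\<^sup>2 * p) * (1 + 16 / n)" by simp
    finally show ?thesis unfolding p by simp
  qed
  have "q\<^sup>2 * (a\<^sup>2 / 4) \<le> q\<^sup>2 * (exp s - 1 - s * (1 + 16 / n))"
  proof (rule mult_left_mono)
    have "s * (16 / n) \<le> 2 * C * (16 / n)" using s N by (intro mult_right_mono) auto
    also have "\<dots> \<le> a\<^sup>2 / 4" using n(2) a N by (simp add: field_simps)
    finally have "s * (16 / n) \<le> a\<^sup>2 / 4" .
    moreover have "1 + s + s\<^sup>2 / 2 \<le> exp s" using s a by (intro exp_lower_Taylor_quadratic) simp
    moreover have "a\<^sup>2 \<le> s\<^sup>2" using s a by (intro power_mono) auto
    moreover have "s * (1 + 16 / n) = s + s * (16 / n)" by (simp add: distrib_left)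
    ultimately show "a\<^sup>2 / 4 \<le> exp s - 1 - s * (1 + 16 / n)" by linarith
  qed simp
  also have "\<dots> = q * (exp s * q) - q\<^sup>2 - s * (q\<^sup>2 * (1 + 16 / n))"
    by (simp add: algebra_simps power2_eq_square)
  also have "\<dots> \<le> q * 1 - q\<^sup>2 - s * p"
    using \<open>exp s * q \<le> 1\<close> p_le q_pos s a by (intro diff_mono mult_left_mono order_refl) auto
  finally have gap: "q\<^sup>2 * (a\<^sup>2 / 4) \<le> q - q\<^sup>2 - s * p" by simp
  have "exp (- 8 * real C) * (a\<^sup>2 / 4) \<le> q\<^sup>2 * (a\<^sup>2 / 4)" using q2 by (intro mult_right_mono) auto
  then have "exp (- 8 * real C) * (a\<^sup>2 / 4) \<le> q - q\<^sup>2 - s * p" using gap by linarith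
  then have "exp (- 8 * real C) * (a\<^sup>2 / 4) * (real n)\<^sup>2 \<le> (q - q\<^sup>2 - s * p) * (real n)\<^sup>2"
    by (intro mult_right_mono) auto
  also have "\<dots> = fixed_curve n j * (n - fixed_curve n j) - n * two_curve n j"
    unfolding fixed_curve_def two_curve_def \<rho>_def[symmetric] q_def[symmetric] p_def[symmetric] s_def
    using N by (simp add: algebra_simps power2_eq_square)
  finally show ?thesis by simp
qed

lemma discrepancy_near_curve:
  assumes n: "2 \<le> n" and \<epsilon>: "0 < \<epsilon>"
    and gap: "\<kappa> * (real n)\<^sup>2 \<le> fixed_curve n j * (n - fixed_curve n j) - n * two_curve n j"
    and err: "curve_error n j \<sigma> < (\<epsilon> * n)\<^sup>2"
  shows "discrepancy n \<sigma> \<le> - (\<kappa> - 2 * \<epsilon>) * (real n)\<^sup>2"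
proof -
  let ?F = "fixed_pts n \<sigma>" and ?f = "fixed_curve n j" and ?D = "two_pts n \<sigma>" and ?u = "two_curve n j"
  have "(?F - ?f)\<^sup>2 \<le> (\<epsilon> * n)\<^sup>2" "(?D - ?u)\<^sup>2 \<le> (\<epsilon> * n)\<^sup>2"
    using err zero_le_power2[of "?F - ?f"] zero_le_power2[of "?D - ?u"]
    unfolding curve_error_def by linarith+
  then have Y: "\<bar>?F - ?f\<bar> \<le> \<epsilon> * n" and Z: "\<bar>?D - ?u\<bar> \<le> \<epsilon> * n"
    using \<epsilon> by (auto simp: abs_le_square_iff[symmetric] abs_mult)
  have "\<bar>?F + ?f - n\<bar> \<le> n"
    using fixed_pts_bounds[of n \<sigma>] curve_bounds[OF n, of j] by linarith
  then have "\<bar>?F - ?f\<bar> * \<bar>?F + ?f - n\<bar> \<le> (\<epsilon> * n) * n" using Y \<epsilon> by (intro mult_mono) auto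
  then have 1: "(?F - ?f) * (?F + ?f - n) \<le> \<epsilon> * (real n)\<^sup>2"
    unfolding abs_mult[symmetric] power2_eq_square by (simp add: abs_le_iff mult.assoc)
  have 2: "n * (?D - ?u) \<le> \<epsilon> * (real n)\<^sup>2"
    using mult_left_mono[of "?D - ?u" "\<epsilon> * n" n] Z by (simp add: abs_le_iff power2_eq_square algebra_simps)
  have "discrepancy n \<sigma> \<le> n * ?D - ?F * (n - ?F)"
    unfolding discrepancy_def using two_pts_bounds[of n \<sigma>] by (simp add: algebra_simps)
  also have "\<dots> = n * (?D - ?u) + (?F - ?f) * (?F + ?f - n) - (?f * (n - ?f) - n * ?u)"
    by (simp add: algebra_simps)
  finally show ?thesis using 1 2 gap by (simp add: algebra_simps)
qed

section \<open>Asymptotic singularity\<close>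

lemma sphere_perm_eq:
  assumes "0 < a" "a < 1"
  shows "sphere_perm n a = {\<sigma> \<in> sym_group n. num_cycles n \<sigma> = n - nat \<lfloor>a * n\<rfloor>}"
proof -
  have "\<lfloor>a * n\<rfloor> \<le> \<lfloor>1 * real n\<rfloor>" using assms by (intro floor_mono mult_right_mono) auto
  then have *: "0 \<le> \<lfloor>a * n\<rfloor>" "\<lfloor>a * n\<rfloor> \<le> int n" using assms by auto
  have "int (cayley_dist n \<sigma>) = \<lfloor>a * n\<rfloor> \<longleftrightarrow> num_cycles n \<sigma> = n - nat \<lfloor>a * n\<rfloor>" if "\<sigma> \<in> sym_group n" for \<sigma>
    unfolding cayley_dist_eq[OF that] using num_cycles_le[of n \<sigma>] * by linarith
  then show ?thesis unfolding sphere_perm_def by auto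
qed

lemma sphere_nonempty:
  assumes "0 < a" "a < 1" "0 < n"
  shows "sphere_perm n a \<noteq> {}"
proof -
  have "a * n < n" "0 \<le> a * n" using assms by auto
  then have "\<lfloor>a * n\<rfloor> < int n" "0 \<le> \<lfloor>a * n\<rfloor>" by (auto simp: floor_less_iff)
  then have "1 \<le> n - nat \<lfloor>a * n\<rfloor>" by linarith
  then obtain \<sigma> where "\<sigma> \<in> sym_group n" "num_cycles n \<sigma> = n - nat \<lfloor>a * n\<rfloor>"
    using ex_num_cycles[of "n - nat \<lfloor>a * n\<rfloor>" n] by auto
  then show ?thesis unfolding sphere_perm_eq[OF assms(1,2)] by blast
qed

lemma measure_sphere_uniform:
  assumes "0 < a" "a < 1" "0 < n" "A \<subseteq> sym_group n"
  shows "measure (sphere_uniform n a) A = card (sphere_perm n a \<inter> A) / card (sphere_perm n a)"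
proof -
  have S: "sphere_perm n a \<subseteq> sym_group n" unfolding sphere_perm_def by blast
  have fin: "finite (sphere_perm n a)" using finite_subset[OF S finite_sym_group] .
  have "emeasure (count_space (sym_group n)) (sphere_perm n a) = card (sphere_perm n a)"
    by (rule emeasure_count_space_finite[OF S fin])
  moreover have "card (sphere_perm n a) \<noteq> 0" using fin sphere_nonempty[OF assms(1-3)] by simp
  ultimately have "measure (sphere_uniform n a) A
      = measure (count_space (sym_group n)) (sphere_perm n a \<inter> A) / measure (count_space (sym_group n)) (sphere_perm n a)"
    unfolding sphere_uniform_def using assms(4) by (intro measure_uniform_measure) auto
  also have "\<dots> = card (sphere_perm n a \<inter> A) / card (sphere_perm n a)"
  proof -
    have "measure (count_space (sym_group n)) X = card X" if "X \<subseteq> sym_group n" for X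
      using that finite_subset[OF that finite_sym_group]
      by (simp add: measure_def emeasure_count_space_finite)
    then show ?thesis using S by (metis le_infI1)
  qed
  finally show ?thesis .
qed

lemma measure_sphere_uniform_ge:
  assumes a: "0 < a" "a < 1" and n: "0 < n" and \<epsilon>: "0 < \<epsilon>"
  shows "1 - 5 / (\<epsilon>\<^sup>2 * n) \<le> measure (sphere_uniform n a) {\<sigma> \<in> sym_group n. - \<epsilon> * (real n)\<^sup>2 < discrepancy n \<sigma>}"
proof -
  let ?S = "sphere_perm n a"
  let ?A = "{\<sigma> \<in> sym_group n. - \<epsilon> * (real n)\<^sup>2 < discrepancy n \<sigma>}"
  let ?B = "{\<sigma> \<in> ?S. discrepancy n \<sigma> \<le> - \<epsilon> * (real n)\<^sup>2}"
  have sub: "?S \<subseteq> sym_group n" unfolding sphere_perm_def by blast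
  have fin: "finite ?S" using finite_subset[OF sub finite_sym_group] .
  have pos: "0 < card ?S" using fin sphere_nonempty[OF a n] by (simp add: card_gt_0_iff)
  have "?S = (?S \<inter> ?A) \<union> ?B" using sub by auto
  moreover have "card ((?S \<inter> ?A) \<union> ?B) = card (?S \<inter> ?A) + card ?B"
    using fin by (intro card_Un_disjoint) auto
  ultimately have "real (card ?S) = card (?S \<inter> ?A) + card ?B" by simp
  moreover have "card ?B \<le> 5 / (\<epsilon>\<^sup>2 * n) * card ?S"
    by (rule card_negative_discrepancy[OF sphere_perm_eq[OF a] \<epsilon> n])
  ultimately have "(1 - 5 / (\<epsilon>\<^sup>2 * n)) * card ?S \<le> card (?S \<inter> ?A)" by (simp add: algebra_simps)
  then have "1 - 5 / (\<epsilon>\<^sup>2 * n) \<le> card (?S \<inter> ?A) / card ?S" using pos by (simp add: pos_le_divide_eq)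
  also have "\<dots> = measure (sphere_uniform n a) ?A"
    by (rule measure_sphere_uniform[OF a n, symmetric]) auto
  finally show ?thesis .
qed

text \<open>
  Two events are excluded. If the walk has few short cycles at time \<open>C n\<close>, it has reached distance
  \<open>\<lfloor>a n\<rfloor>\<close> by then. If it stays near the curves up to time \<open>C n\<close>, then at the hitting time, which is
  at least \<open>a n / 2\<close>, the gap of the curves makes the discrepancy at most \<open>- \<kappa> n\<^sup>2 / 2\<close>. The term
  with \<open>e\<^sup>-\<^sup>C\<^sup>/\<^sup>2\<close> is the only one that does not vanish as \<open>n\<close> grows.
\<close>

lemma measure_hitting_law_discrepancy_le:
  fixes a :: real and C L :: nat
  defines "\<kappa> \<equiv> exp (- 8 * real C) * a\<^sup>2 / 4"
  assumes a: "0 < a" "a < 1" and L: "2 / (1 - a) \<le> L"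
    and n: "5 \<le> n" "2 * L \<le> n" "2 / a \<le> n" "128 * real C / a\<^sup>2 \<le> n"
  shows "measure (hitting_law n a) {\<sigma> \<in> sym_group n. - (\<kappa> / 2) * (real n)\<^sup>2 < discrepancy n \<sigma>}
    \<le> 2 * exp (- (real C / 2)) / (1 - a) + (8 * real L * real C / (1 - a) + 1400 * real C * exp (8 * real C) / (\<kappa> / 4)\<^sup>2) / n"
proof -
  let ?K = "C * n" and ?A = "{\<sigma> \<in> sym_group n. - (\<kappa> / 2) * (real n)\<^sup>2 < discrepancy n \<sigma>}"
  let ?r = "(\<kappa> / 4 * n)\<^sup>2" and ?h = "(1 - a) * n / 2"
  let ?W = "walk_space n"
  let ?B1 = "{\<omega> \<in> space ?W. \<exists>i\<le>?K. ?r \<le> curve_error n i (jump_chain \<omega> i)}"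
  let ?B2 = "{\<omega> \<in> space ?W. ?h \<le> short_cycles n L (jump_chain \<omega> ?K)}"
  have n2: "2 \<le> n" "4 \<le> n" using n by auto
  have N: "0 < real n" using n by simp
  have \<kappa>: "0 < \<kappa>" unfolding \<kappa>_def using a by simp
  interpret prob_space ?W by (rule prob_space_walk[OF n2(1)])
  define m where "m = nat \<lfloor>a * n\<rfloor>"
  have m: "int m = \<lfloor>a * n\<rfloor>" unfolding m_def using a by simp
  have m_le: "real m \<le> a * n" "a * n - 1 < real m" using m by linarith+
  have an: "2 \<le> a * n" using n(3) a by (simp add: field_simps)
  have "1 \<le> m" using an m_le by linarith
  have "0 < L" using L a by (cases L) auto
  have B1: "?B1 \<in> sets ?W" by (rule sets_exceeds)
  have B2: "?B2 \<in> sets ?W"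
  proof -
    have "?B2 = (\<lambda>\<omega>. jump_chain \<omega> ?K) -` {\<sigma> \<in> sym_group n. ?h \<le> short_cycles n L \<sigma>} \<inter> space ?W"
      using jump_chain_in_sym_group by auto
    also have "\<dots> \<in> sets ?W" by (intro measurable_sets[OF measurable_jump_chain]) auto
    finally show ?thesis .
  qed
  have "measure (hitting_law n a) ?A \<le> measure ?W (?B1 \<union> ?B2)"
  proof (rule measure_hitting_law_le[OF n2(1)])
    show "?B1 \<union> ?B2 \<in> sets ?W" using B1 B2 by blast
    fix \<omega> assume \<omega>: "\<omega> \<in> space ?W" and pos: "\<And>i. 0 < fst (\<omega> i)" and in_A: "walk \<omega> (hitting_time n a \<omega>) \<in> ?A"
    show "\<omega> \<in> ?B1 \<union> ?B2"
    proof (rule ccontr)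
      assume out: "\<omega> \<notin> ?B1 \<union> ?B2"
      let ?X = "jump_chain \<omega>"
      have short: "short_cycles n L (?X ?K) < ?h" using out \<omega> by force
      have "real n / L \<le> ?h"
      proof -
        have "2 \<le> (1 - a) * L" using L a by (simp add: field_simps)
        then have "2 * real n \<le> (1 - a) * L * n" using N by (intro mult_right_mono) auto
        then show ?thesis using \<open>0 < L\<close> by (simp add: field_simps)
      qed
      moreover have "?h + ?h = n - a * n" by (simp add: field_simps)
      ultimately have "num_cycles n (?X ?K) \<le> n - a * n"
        using short num_cycles_le_short[OF jump_chain_in_sym_group[OF \<omega>] \<open>0 < L\<close>, of ?K]
        by linarith
      then have "m \<le> n - num_cycles n (?X ?K)" using m_le(1) by linarith
      then have "m \<le> cayley_dist n (?X ?K)"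
        unfolding cayley_dist_eq[OF jump_chain_in_sym_group[OF \<omega>]] .
      then obtain k where k: "k \<le> ?K" "m \<le> k" "cayley_dist n (?X k) = m"
        "\<And>i. i < k \<Longrightarrow> cayley_dist n (?X i) < m"
        using first_passage[OF \<omega>, of m ?K] by blast
      have "walk \<omega> (hitting_time n a \<omega>) = ?X k"
      proof (rule walk_hitting_time[OF pos])
        show "int (cayley_dist n (?X k)) = \<lfloor>a * n\<rfloor>" using k(3) m by simp
        show "int (cayley_dist n (?X i)) \<noteq> \<lfloor>a * n\<rfloor>" if "i < k" for i
          using k(4)[OF that] m by linarith
        show "0 < k" using k(2) \<open>1 \<le> m\<close> by linarith
      qed
      moreover have "discrepancy n (?X k) \<le> - (\<kappa> - 2 * (\<kappa> / 4)) * (real n)\<^sup>2"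
      proof (rule discrepancy_near_curve[OF n2(1)])
        show "0 < \<kappa> / 4" using \<kappa> by simp
        have "a / 2 * n \<le> k" using m_le(2) an k(2) by linarith
        then show "\<kappa> * (real n)\<^sup>2 \<le> fixed_curve n k * (n - fixed_curve n k) - n * two_curve n k"
          unfolding \<kappa>_def using k(1) by (intro curve_gap[OF a(1) n2(2) n(4)])
        show "curve_error n k (?X k) < ?r" using out \<omega> k(1) by force
      qed
      ultimately show False using in_A by simp
    qed
  qed
  also have "\<dots> \<le> measure ?W ?B1 + measure ?W ?B2" using B1 B2 by (rule measure_Un_le)
  also have "measure ?W ?B1 \<le> 1400 * real C * exp (8 * real C) / (\<kappa> / 4)\<^sup>2 / n"
  proof -
    have "measure ?W ?B1 \<le> 1400 * real ?K * (1 + 8 / real n) ^ ?K / ?r"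
      using \<kappa> N by (intro prob_curve_error_le n) auto
    also have "(1 + 8 / real n) ^ ?K \<le> exp (8 * real C)"
    proof -
      have "(1 + 8 / real n) ^ ?K \<le> exp (8 / n) ^ ?K"
        by (intro power_mono exp_ge_add_one_self) simp
      also have "\<dots> = exp (8 * real C)" using N by (simp flip: exp_of_nat_mult)
      finally show ?thesis .
    qed
    then have "1400 * real ?K * (1 + 8 / real n) ^ ?K / ?r \<le> 1400 * real ?K * exp (8 * real C) / ?r"
      by (intro divide_right_mono mult_left_mono) auto
    also have "\<dots> = 1400 * real C * exp (8 * real C) / (\<kappa> / 4)\<^sup>2 / n"
      using N by (simp add: power_mult_distrib power2_eq_square)
    finally show ?thesis .
  qed
  also have "measure ?W ?B2 \<le> 2 * exp (- (real C / 2)) / (1 - a) + 8 * real L * real C / (1 - a) / n"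
  proof -
    have "measure ?W ?B2 \<le> ((1 - 1 / (2 * real n)) ^ ?K * n + 4 * real L / n * ?K) / ?h"
      using a N by (intro prob_short_cycles_le n(2) n2(1)) auto
    also have "(1 - 1 / (2 * real n)) ^ ?K \<le> exp (- (real C / 2))"
    proof -
      have "(1 - 1 / (2 * real n)) ^ ?K \<le> exp (- (1 / (2 * n))) ^ ?K"
        using exp_ge_add_one_self[of "- (1 / (2 * real n))"] N n2 by (intro power_mono) (auto simp: field_simps)
      also have "\<dots> = exp (- (real C / 2))" using N by (simp flip: exp_of_nat_mult)
      finally show ?thesis .
    qed
    then have "((1 - 1 / (2 * real n)) ^ ?K * n + 4 * real L / n * ?K) / ?h
        \<le> (exp (- (real C / 2)) * n + 4 * real L / n * ?K) / ?h"
      using a by (intro divide_right_mono add_right_mono mult_right_mono) auto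
    also have "\<dots> = 2 * exp (- (real C / 2)) / (1 - a) + 8 * real L * real C / (1 - a) / n"
    proof -
      have "(x * n + 4 * real L / n * ?K) / (b * n / 2) = 2 * x / b + 8 * real L * real C / b / n"
        if "b \<noteq> 0" for x b :: real
        using that N by (simp add: field_simps)
      then show ?thesis using a by simp
    qed
    finally show ?thesis .
  qed
  finally show ?thesis by (simp add: add_divide_distrib)
qed

lemma measure_hitting_law_le_1: "2 \<le> n \<Longrightarrow> measure (hitting_law n a) A \<le> 1"
  using measure_hitting_law_le[of n "space (walk_space n)" a A] prob_space.prob_space[OF prob_space_walk]
  by simp

lemma measure_sphere_uniform_le_1:
  assumes "0 < a" "a < 1" "0 < n" "A \<subseteq> sym_group n"
  shows "measure (sphere_uniform n a) A \<le> 1"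
proof -
  have "finite (sphere_perm n a)"
    unfolding sphere_perm_def using finite_sym_group by simp
  then have "card (sphere_perm n a \<inter> A) \<le> card (sphere_perm n a)" by (intro card_mono) auto
  then show ?thesis unfolding measure_sphere_uniform[OF assms] 
    by (cases "card (sphere_perm n a) = 0") (auto simp: divide_le_eq_1)
qed

lemma tv_dist_bounds:
  assumes a: "0 < a" "a < 1" and n: "2 \<le> n" and A: "A \<subseteq> sym_group n"
  shows "measure (sphere_uniform n a) A - measure (hitting_law n a) A
      \<le> tv_dist (sphere_uniform n a) (hitting_law n a)"
    "tv_dist (sphere_uniform n a) (hitting_law n a) \<le> 1"
proof -
  let ?d = "\<lambda>A. \<bar>measure (sphere_uniform n a) A - measure (hitting_law n a) A\<bar>"
  have sets: "sets (sphere_uniform n a) = Pow (sym_group n)" unfolding sphere_uniform_def by simp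
  have d: "?d A \<le> 1" if "A \<in> sets (sphere_uniform n a)" for A
  proof -
    have "measure (sphere_uniform n a) A \<le> 1"
      using that n unfolding sets by (intro measure_sphere_uniform_le_1[OF a]) auto
    then show ?thesis
      using measure_hitting_law_le_1[OF n, of a A] measure_nonneg[of "sphere_uniform n a" A]
        measure_nonneg[of "hitting_law n a" A] by linarith
  qed
  then have "bdd_above (?d ` sets (sphere_uniform n a))" by (intro bdd_aboveI2)
  then have "?d A \<le> tv_dist (sphere_uniform n a) (hitting_law n a)"
    unfolding tv_dist_def using A by (intro cSUP_upper) (auto simp: sets)
  then show "measure (sphere_uniform n a) A - measure (hitting_law n a) A
      \<le> tv_dist (sphere_uniform n a) (hitting_law n a)" by linarith
  show "tv_dist (sphere_uniform n a) (hitting_law n a) \<le> 1"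
    unfolding tv_dist_def using d by (intro cSUP_least) (auto simp: sets)
qed

theorem theorem5:
  fixes a :: real
  assumes "0 < a" and "a < 1"
  shows "(\<lambda>n. tv_dist (sphere_uniform n a) (hitting_law n a)) \<longlonglongrightarrow> 1"
proof (rule LIMSEQ_I)
  fix \<eta> :: real assume \<eta>: "0 < \<eta>"
  define L where "L = nat \<lceil>2 / (1 - a)\<rceil>"
  have L: "2 / (1 - a) \<le> L" unfolding L_def by linarith
  have "(\<lambda>C. 2 * exp (- (1 / 2)) ^ C / (1 - a)) \<longlonglongrightarrow> 2 * 0 / (1 - a)"
    using assms by (intro tendsto_intros LIMSEQ_realpow_zero) auto
  then have "\<forall>\<^sub>F C in sequentially. 2 * exp (- (1 / 2)) ^ C / (1 - a) < \<eta> / 2"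
    using \<eta> by (intro order_tendstoD(2)) auto
  then obtain C :: nat where "2 * exp (- (1 / 2)) ^ C / (1 - a) < \<eta> / 2"
    by (auto simp: eventually_sequentially)
  moreover have "exp (- (1 / 2)) ^ C = exp (- (real C / 2))" by (simp flip: exp_of_nat_mult)
  ultimately have C: "2 * exp (- (real C / 2)) / (1 - a) < \<eta> / 2" by simp
  define \<kappa> where "\<kappa> = exp (- 8 * real C) * a\<^sup>2 / 4"
  have \<kappa>: "0 < \<kappa>" unfolding \<kappa>_def using assms by simp
  define c where "c = 8 * real L * real C / (1 - a) + 1400 * real C * exp (8 * real C) / (\<kappa> / 4)\<^sup>2"
  define c' where "c' = 5 / (\<kappa> / 2)\<^sup>2"
  have "\<forall>\<^sub>F n in sequentially. (c + c') / real n < \<eta> / 2"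
    using \<eta> by (intro order_tendstoD(2)[OF lim_const_over_n]) auto
  moreover have "\<forall>\<^sub>F n in sequentially. x \<le> real n" for x
    using filterlim_real_sequentially by (simp add: filterlim_at_top)
  then have "\<forall>\<^sub>F n in sequentially. 2 / a \<le> real n" "\<forall>\<^sub>F n in sequentially. 128 * real C / a\<^sup>2 \<le> real n"
    by blast+
  moreover have "\<forall>\<^sub>F n in sequentially. 5 \<le> n" "\<forall>\<^sub>F n in sequentially. 2 * L \<le> n"
    by (rule eventually_ge_at_top)+
  ultimately have "\<forall>\<^sub>F n in sequentially. norm (tv_dist (sphere_uniform n a) (hitting_law n a) - 1) < \<eta>"
  proof eventually_elim
    case (elim n)
    let ?A = "{\<sigma> \<in> sym_group n. - (\<kappa> / 2) * (real n)\<^sup>2 < discrepancy n \<sigma>}"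
    have n: "2 \<le> n" "0 < n" using elim by auto
    have "1 - c' / n \<le> measure (sphere_uniform n a) ?A"
      using measure_sphere_uniform_ge[OF assms n(2), of "\<kappa> / 2"] \<kappa> unfolding c'_def by simp
    moreover have "measure (hitting_law n a) ?A \<le> 2 * exp (- (real C / 2)) / (1 - a) + c / n"
      unfolding c_def \<kappa>_def using elim L assms 
      by (intro measure_hitting_law_discrepancy_le) auto
    moreover have "measure (sphere_uniform n a) ?A - measure (hitting_law n a) ?A
        \<le> tv_dist (sphere_uniform n a) (hitting_law n a)"
      by (rule tv_dist_bounds(1)[OF assms n(1)]) auto
    moreover have "tv_dist (sphere_uniform n a) (hitting_law n a) \<le> 1"
      by (rule tv_dist_bounds(2)[OF assms n(1), of "{}"]) auto
    moreover have "(c + c') / n = c / n + c' / n" by (rule add_divide_distrib)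
    ultimately show ?case using C elim(1) by simp
  qed
  then show "\<exists>no. \<forall>n\<ge>no. norm (tv_dist (sphere_uniform n a) (hitting_law n a) - 1) < \<eta>"
    by (simp add: eventually_sequentially)
qed

end
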